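(* Let $\theta$ be a finite Blaschke product of order $n$. (1) Given a $C_{\theta}$-real basis $v_1,\dots,v_n$ for $K_{\theta}$ and a modified Clark basis $\mathbf{cb}_1,\dots,\mathbf{cb}_n$ for $K_{\theta}$, there exists an orthogonal matrix $U_r$ such that $v_i = T U_r e_i$ for all $i$, where $T: \mathbb{C}^n \to K_{\theta}$ is the linear map with $T e_i = \mathbf{cb}_i$. Conversely, given any orthogonal $n\times n$ matrix $U_r$ and any modified Clark basis $\mathbf{cb}_1,\dots,\mathbf{cb}_n$ for $K_\theta$, with $T$ defined in the same way, the vectors $T U_r e_i$, $i=1,\dots,n$, form a $C_{\theta}$-real basis for $K_{\theta}$. (2) Furthermore, for $v_i = T U_r e_i$ ($i=1,\dots,n$), with $U_r$ orthogonal and $T$ as in (1), and for every truncated Toeplitz operator $A$ on $K_\theta$, we have $$[A]_{v_i} = U_r^{-1}[A]_{\mathbf{cb}_i} U_r.$$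
   Context: $\mathbb{D}$ is the open unit disc in $\mathbb{C}$ and $\mathbb{T}$ the unit circle. $H^2$ is the Hardy space of the disc, viewed via radial boundary values as a closed subspace of $L^2(\mathbb{T})$ (normalized Lebesgue measure; inner product linear in the first variable). A finite Blaschke product $\theta$ has order $n$ if it has $n$ zeros in $\mathbb{D}$ counted with multiplicity. The model space is $K_\theta = H^2 \ominus \theta H^2$; for $\theta$ a finite Blaschke product of order $n$ it has dimension $n$ and every $f\in K_\theta$ has a well-defined value at every point of $\mathbb{T}$. For $\zeta\in\mathbb{D}\cup\mathbb{T}$ the reproducing kernel is $k_\zeta(z)=\frac{1-\overline{\theta(\zeta)}\theta(z)}{1-\overline{\zeta}z}\in K_\theta$. The canonical conjugation on $K_\theta$ is the antilinear isometric involution $C_\theta f = \theta\,\overline{z f}$ (functions on $\mathbb{T}$). A $C_\theta$-real basis for $K_\theta$ is an orthonormal basis $v_1,\dots,v_n$ of $K_\theta$ with $C_\theta v_j = v_j$ for all $j$. Modified Clark basis: for parameters $t\in\mathbb{D}$ and $\alpha\in\mathbb{T}$ put $w=\frac{\alpha+\theta(t)}{1+\overline{\theta(t)}\alpha}\in\mathbb{T}$. There are exactly $n$ distinct points $\eta_1,\dots,\eta_n$ with $\theta(\eta_i)=w$, all lying on $\mathbb{T}$. The corresponding modified Clark basis is the $C_\theta$-real basis of $K_\theta$ $$\mathbf{cb}_i(z)=\left(\overline{\eta_i}\,w\right)^{\frac12}\frac{k_{\eta_i}(z)}{\|k_{\eta_i}\|},\qquad i=1,\dots,n,$$ where the square root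 is the unimodular number with argument $\frac{\delta_1+\delta_2}{2}$, $\delta_1=\arg(\overline{\eta_i})\in[0,2\pi)$, $\delta_2=\arg(w)\in[0,2\pi)$. A modified Clark basis is any basis arising in this way for some $t\in\mathbb{D}$, $\alpha\in\mathbb{T}$. A truncated Toeplitz operator (TTO) on $K_\theta$ is an operator of the form $A_\phi f = P_\theta(\phi f)$, $f \in K_\theta$, for some $\phi\in L^\infty(\mathbb{T})$, where $P_\theta: L^2(\mathbb{T})\to K_\theta$ is the orthogonal projection. $[A]_{v_i}$ denotes the matrix of $A$ with respect to the basis $v_1,\dots,v_n$, with $(i,j)$ entry $\langle A v_j, v_i\rangle$. An orthogonal matrix is a real matrix $U$ with $UU^T=U^TU=I$; $e_1,\dots,e_n$ is the standard basis of $\mathbb{C}^n$. *)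

theory Defs
  imports "HOL-Analysis.Analysis"
begin

text \<open>
  Elements of \<open>L\<^sup>2\<close> of the circle are represented by functions \<open>complex \<Rightarrow> complex\<close>, of which only the
  values on the unit circle matter; equality of elements is \<open>L2_eq\<close>, not equality of functions.
\<close>

definition circle_measure :: "complex measure" where
  "circle_measure =
     distr (uniform_measure lborel {0..<2 * pi}) (restrict_space borel (sphere 0 1)) cis"

definition L2_circle :: "(complex \<Rightarrow> complex) set" where
  "L2_circle = {f \<in> borel_measurable circle_measure.
                  integrable circle_measure (\<lambda>z. (cmod (f z))\<^sup>2)}"

definition Linf_circle :: "(complex \<Rightarrow> complex) set" where
  "Linf_circle = {f \<in> borel_measurable circle_measure.
                    \<exists>B. AE z in circle_measure. cmod (f z) \<le> B}"

definition L2_inner :: "(complex \<Rightarrow> complex) \<Rightarrow> (complex \<Rightarrow> complex) \<Rightarrow> complex" where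
  "L2_inner f g = (LINT z|circle_measure. f z * cnj (g z))"

definition L2_norm :: "(complex \<Rightarrow> complex) \<Rightarrow> real" where
  "L2_norm f = sqrt (LINT z|circle_measure. (cmod (f z))\<^sup>2)"

definition L2_eq :: "(complex \<Rightarrow> complex) \<Rightarrow> (complex \<Rightarrow> complex) \<Rightarrow> bool" where
  "L2_eq f g \<longleftrightarrow> f \<in> L2_circle \<and> g \<in> L2_circle \<and> (AE z in circle_measure. f z = g z)"

definition hardy_disc :: "(complex \<Rightarrow> complex) set" where
  "hardy_disc = {F. F holomorphic_on ball 0 1 \<and>
     (\<exists>B. \<forall>r\<in>{0<..<1}. (LINT z|circle_measure. (cmod (F (of_real r * z)))\<^sup>2) \<le> B)}"

definition hardy_circle :: "(complex \<Rightarrow> complex) set" where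
  "hardy_circle = {f \<in> L2_circle. \<exists>F \<in> hardy_disc.
     AE z in circle_measure. ((\<lambda>r. F (of_real r * z)) \<longlongrightarrow> f z) (at_left (1::real))}"

text \<open>Only the values on the closed disc are constrained.\<close>

definition finite_blaschke :: "(complex \<Rightarrow> complex) \<Rightarrow> nat \<Rightarrow> bool" where
  "finite_blaschke \<theta> n \<longleftrightarrow>
     (\<exists>c a. cmod c = 1 \<and> (\<forall>j<n. a j \<in> ball 0 1) \<and>
        (\<forall>z\<in>cball 0 1. \<theta> z = c * (\<Prod>j<n. (z - a j) / (1 - cnj (a j) * z))))"

definition model_space :: "(complex \<Rightarrow> complex) \<Rightarrow> (complex \<Rightarrow> complex) set" where
  "model_space \<theta> = {f \<in> hardy_circle. \<forall>h\<in>hardy_circle. L2_inner f (\<lambda>z. \<theta> z * h z) = 0}"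

definition model_conj :: "(complex \<Rightarrow> complex) \<Rightarrow> (complex \<Rightarrow> complex) \<Rightarrow> complex \<Rightarrow> complex" where
  "model_conj \<theta> f = (\<lambda>z. \<theta> z * cnj (z * f z))"

text \<open>
  For \<open>\<zeta>\<close> on the circle, the quotient is \<open>0 / 0 = 0\<close> at \<open>z = \<zeta>\<close> instead of the value of the continuous
  extension; as an element of \<open>L\<^sup>2\<close> it is the same.
\<close>

definition model_kernel :: "(complex \<Rightarrow> complex) \<Rightarrow> complex \<Rightarrow> complex \<Rightarrow> complex" where
  "model_kernel \<theta> \<zeta> = (\<lambda>z. (1 - cnj (\<theta> \<zeta>) * \<theta> z) / (1 - cnj \<zeta> * z))"

text \<open>The linear map from coordinate vectors that sends the \<open>i\<close>-th standard basis vector to \<open>v i\<close>.\<close>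

definition basis_map :: "('n::finite \<Rightarrow> complex \<Rightarrow> complex) \<Rightarrow> complex ^ 'n \<Rightarrow> complex \<Rightarrow> complex" where
  "basis_map v x = (\<lambda>z. \<Sum>i\<in>UNIV. x $ i * v i z)"

definition C_real_basis ::
  "(complex \<Rightarrow> complex) \<Rightarrow> ('n::finite \<Rightarrow> complex \<Rightarrow> complex) \<Rightarrow> bool" where
  "C_real_basis \<theta> v \<longleftrightarrow>
     (\<forall>i. v i \<in> model_space \<theta>) \<and>
     (\<forall>i j. L2_inner (v i) (v j) = (if i = j then 1 else 0)) \<and>
     (\<forall>f\<in>model_space \<theta>. \<exists>x. L2_eq f (basis_map v x)) \<and>
     (\<forall>i. L2_eq (model_conj \<theta> (v i)) (v i))"

definition clark_vector :: "(complex \<Rightarrow> complex) \<Rightarrow> complex \<Rightarrow> complex \<Rightarrow> complex \<Rightarrow> complex" where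
  "clark_vector \<theta> w \<eta> =
     (\<lambda>z. cis ((Arg2pi (cnj \<eta>) + Arg2pi w) / 2) *
          (model_kernel \<theta> \<eta> z / of_real (L2_norm (model_kernel \<theta> \<eta>))))"

definition modified_clark_basis ::
  "(complex \<Rightarrow> complex) \<Rightarrow> ('n::finite \<Rightarrow> complex \<Rightarrow> complex) \<Rightarrow> bool" where
  "modified_clark_basis \<theta> cb \<longleftrightarrow>
     (\<exists>t\<in>ball 0 1. \<exists>\<alpha>\<in>sphere 0 1. \<exists>w \<eta>.
        w = (\<alpha> + \<theta> t) / (1 + cnj (\<theta> t) * \<alpha>) \<and>
        bij_betw \<eta> UNIV {\<zeta> \<in> sphere 0 1. \<theta> \<zeta> = w} \<and>
        (\<forall>i. L2_eq (cb i) (clark_vector \<theta> w (\<eta> i))))"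

text \<open>The orthogonal projection onto the model space; it is determined up to \<open>L2_eq\<close>.\<close>

definition model_proj :: "(complex \<Rightarrow> complex) \<Rightarrow> (complex \<Rightarrow> complex) \<Rightarrow> complex \<Rightarrow> complex" where
  "model_proj \<theta> g =
     (SOME p. p \<in> model_space \<theta> \<and> (\<forall>f\<in>model_space \<theta>. L2_inner (\<lambda>z. g z - p z) f = 0))"

definition truncated_toeplitz ::
  "(complex \<Rightarrow> complex) \<Rightarrow> ((complex \<Rightarrow> complex) \<Rightarrow> complex \<Rightarrow> complex) \<Rightarrow> bool" where
  "truncated_toeplitz \<theta> A \<longleftrightarrow>
     (\<exists>\<phi>\<in>Linf_circle. \<forall>f\<in>model_space \<theta>. L2_eq (A f) (model_proj \<theta> (\<lambda>z. \<phi> z * f z)))"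

definition op_matrix ::
  "((complex \<Rightarrow> complex) \<Rightarrow> complex \<Rightarrow> complex) \<Rightarrow> ('n::finite \<Rightarrow> complex \<Rightarrow> complex)
     \<Rightarrow> complex ^ 'n ^ 'n" where
  "op_matrix A v = (\<chi> i j. L2_inner (A (v j)) (v i))"

abbreviation complex_matrix :: "real ^ 'n ^ 'n \<Rightarrow> complex ^ 'n ^ 'n" where
  "complex_matrix U \<equiv> map_matrix complex_of_real U"

end

theory Submission
  imports Defs "HOL-Complex_Analysis.Cauchy_Integral_Formula"
begin

text \<open>
  Once a modified Clark basis is known to be a \<open>C\<^sub>\<theta>\<close>-real basis, all three claims are linear algebra.
  The conjugation satisfies \<open>\<langle>C f, C g\<rangle> = \<langle>g, f\<rangle>\<close>, so two vectors that it fixes have a real inner product.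
  The matrix that expresses one \<open>C\<^sub>\<theta>\<close>-real basis in another is therefore real, and orthonormality of
  both bases makes it orthogonal (\<open>C_real_basis_change\<close>). Conversely, a real orthogonal matrix preserves
  orthonormality and commutes with the antilinear conjugation (\<open>C_real_basis_orthogonal_image\<close>). For a
  truncated Toeplitz operator with symbol \<open>\<phi>\<close>, the entry \<open>\<langle>A f, g\<rangle>\<close> equals \<open>\<langle>\<phi> f, g\<rangle>\<close>, which is
  sesquilinear, so the matrix transforms by \<open>U\<^sup>T [A] U\<close> (\<open>op_matrix_change\<close>).

  The analytic content is that the Clark vectors are such a basis, in particular that they span the model
  space. Write \<open>\<theta> = c P / Q\<close> with \<open>P = \<Prod>(z - a\<^sub>j)\<close> and \<open>Q = \<Prod>(1 - cnj a\<^sub>j z)\<close> (\<open>numer\<close> and \<open>denom\<close>), where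
  \<open>Q\<close> does not vanish on the closed disc. Then
  \<open>K\<^sub>\<theta>\<close> consists of the functions \<open>p / Q\<close> with \<open>p\<close> a polynomial of degree less than \<open>n\<close>
  (\<open>model_space_iff\<close>). On the circle \<open>P = z\<^sup>n cnj Q\<close>, so orthogonality of \<open>f\<close> to \<open>\<theta> Q z\<^sup>k\<close> says that the
  Fourier coefficients of \<open>f Q\<close> vanish from index \<open>n\<close> on. These are the Taylor coefficients of \<open>F Q\<close>,
  where \<open>F\<close> is the analytic function with boundary values \<open>f\<close> (\<open>radial_boundary_Fourier_coefficient\<close>);
  hence \<open>F Q\<close> is a polynomial, and \<open>f\<close> is recovered from \<open>F\<close> by its radial limits.

  For \<open>\<eta>\<close> on the circle, \<open>k\<^sub>\<eta>\<close> is of the form \<open>K / Q\<close> as well, because the zero of its denominator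
  cancels, and \<open>\<langle>f, k\<^sub>\<eta>\<rangle> = f(\<eta>)\<close> for \<open>f\<close> in \<open>K\<^sub>\<theta>\<close> (\<open>boundary_reproducing\<close>). If
  \<open>\<theta>(\<eta>\<^sub>i) = \<theta>(\<eta>\<^sub>j)\<close> with \<open>i \<noteq> j\<close>, then \<open>k\<^sub>\<eta>\<^sub>i\<close> vanishes at \<open>\<eta>\<^sub>j\<close>, so the kernels are orthogonal; and since
  a polynomial of degree less than \<open>n\<close> is determined by its values at \<open>\<eta>\<^sub>1, \<dots>, \<eta>\<^sub>n\<close>, they span
  (\<open>clark_basis_is_C_real_basis\<close>).
\<close>

section \<open>The normalized measure on the circle\<close>

lemma space_circle [simp]: "space circle_measure = sphere 0 1"
  by (simp add: circle_measure_def space_restrict_space)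

lemma sets_circle [measurable_cong]: "sets circle_measure = sets (restrict_space borel (sphere 0 1))"
  by (simp add: circle_measure_def)

lemma cis_measurable_sphere:
  "cis \<in> uniform_measure lborel {0..<2 * pi} \<rightarrow>\<^sub>M restrict_space borel (sphere 0 1)"
proof (rule measurable_restrict_space2)
  have "continuous_on UNIV cis"
    by (intro continuous_intros)
  then have "cis \<in> borel_measurable borel"
    by (rule borel_measurable_continuous_onI)
  then show "cis \<in> borel_measurable (uniform_measure lborel {0..<2 * pi})"
    by (simp add: measurable_def)
qed auto

lemma finite_measure_circle: "finite_measure circle_measure"
proof (rule finite_measureI)
  have "emeasure circle_measure (space circle_measure)
      = emeasure (uniform_measure lborel {0..<2 * pi}) UNIV"
  proof -
    have "cis -` sphere 0 1 = UNIV" by auto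
    moreover have "sphere 0 1 \<in> sets (restrict_space borel (sphere (0::complex) 1))"
      by (subst sets_restrict_space_iff) auto
    ultimately show ?thesis
      unfolding space_circle
      by (simp add: circle_measure_def emeasure_distr[OF cis_measurable_sphere])
  qed
  also have "\<dots> = 1"
    by (subst emeasure_uniform_measure) (auto simp: ennreal_divide_self)
  finally show "emeasure circle_measure (space circle_measure) \<noteq> \<infinity>" by simp
qed

interpretation circle: finite_measure circle_measure
  by (rule finite_measure_circle)

lemma integral_circle:
  fixes f :: "complex \<Rightarrow> complex"
  assumes f: "f \<in> borel_measurable circle_measure"
  shows "(LINT z|circle_measure. f z)
       = (LINT t|lborel. indicator {0..2*pi} t *\<^sub>R f (cis t)) / (2 * pi)"
proof -
  have f': "f \<in> borel_measurable (restrict_space borel (sphere 0 1))"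
    using f by (simp add: measurable_cong_sets[OF sets_circle refl])
  have m: "(\<lambda>t. f (cis t)) \<in> borel_measurable lborel"
    using measurable_compose[OF cis_measurable_sphere f'] by simp
  have "(LINT z|circle_measure. f z) = (LINT t|uniform_measure lborel {0..<2 * pi}. f (cis t))"
    unfolding circle_measure_def by (rule integral_distr[OF cis_measurable_sphere f'])
  also have "uniform_measure lborel {0..<2 * pi}
      = density lborel (\<lambda>t. ennreal (indicator {0..<2 * pi} t / (2 * pi)))"
    unfolding uniform_measure_def
    by (rule arg_cong[where f = "density lborel"])
      (auto simp: fun_eq_iff indicator_def divide_ennreal[symmetric])
  also have "(LINT t|\<dots>. f (cis t)) = (LINT t|lborel. (indicator {0..<2 * pi} t / (2 * pi)) *\<^sub>R f (cis t))"
    using m by (intro integral_density) auto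
  also have "\<dots> = (LINT t|lborel. (indicator {0..2*pi} t *\<^sub>R f (cis t)) / (2 * pi))"
  proof (rule integral_cong_AE)
    show "AE t in lborel. (indicator {0..<2 * pi} t / (2 * pi)) *\<^sub>R f (cis t) =
      (indicator {0..2*pi} t *\<^sub>R f (cis t)) / complex_of_real (2 * pi)"
      using AE_lborel_singleton[of "2*pi"]
      by eventually_elim (auto simp: indicator_def scaleR_conv_of_real)
  qed (use m in measurable)
  finally show ?thesis by simp
qed

lemma continuous_measurable_circle:
  fixes f :: "complex \<Rightarrow> 'a::topological_space"
  assumes "continuous_on (sphere 0 1) f"
  shows "f \<in> borel_measurable circle_measure"
  using borel_measurable_continuous_on_restrict[OF assms]
  by (simp add: measurable_cong_sets[OF sets_circle refl])

lemma bounded_integrable_circle: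
  fixes f :: "complex \<Rightarrow> 'a::{banach, second_countable_topology}"
  assumes "f \<in> borel_measurable circle_measure" "\<And>z. cmod z = 1 \<Longrightarrow> norm (f z) \<le> B"
  shows "integrable circle_measure f"
  by (rule circle.integrable_const_bound[where B = B]) (use assms in auto)

lemma continuous_integrable_circle:
  fixes f :: "complex \<Rightarrow> 'a::{banach, second_countable_topology}"
  assumes f: "continuous_on (sphere 0 1) f"
  shows "integrable circle_measure f"
proof -
  have "bounded (f ` sphere 0 1)"
    by (intro compact_imp_bounded compact_continuous_image f) auto
  then obtain B where "\<And>z. z \<in> sphere 0 1 \<Longrightarrow> norm (f z) \<le> B"
    unfolding bounded_iff by blast
  then show ?thesis
    by (intro bounded_integrable_circle[where B = B] continuous_measurable_circle f) auto
qed

lemma integral_circle_int_power: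
  "(LINT z|circle_measure. z powi k) = (if k = 0 then 1 else 0)"
proof -
  have c: "continuous_on (sphere 0 1) (\<lambda>z::complex. z powi k)"
    by (intro continuous_intros) auto
  have *: "(LINT z|circle_measure. z powi k)
      = (LINT t|lborel. indicator {0..2*pi} t *\<^sub>R cis (of_int k * t)) / (2 * pi)"
    by (subst integral_circle[OF continuous_measurable_circle[OF c]]) (simp add: cis_power_int)
  show ?thesis
  proof (cases "k = 0")
    case True
    then show ?thesis
      unfolding * by (simp add: scaleR_conv_of_real)
  next
    case False
    let ?F = "\<lambda>t. cis (of_int k * t) / (\<i> * of_int k)"
    have d: "(?F has_vector_derivative cis (of_int k * t)) (at t within {0..2*pi})" for t
    proof -
      have "((\<lambda>t. exp (\<i> * (of_int k * complex_of_real t)) / (\<i> * of_int k)) has_vector_derivative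
          exp (\<i> * (of_int k * of_real t))) (at t within {0..2*pi})"
        by (rule has_vector_derivative_real_field)
          (use False in \<open>auto intro!: derivative_eq_intros simp: field_simps\<close>)
      then show ?thesis by (simp add: cis_conv_exp)
    qed
    have cis: "cis (of_int k * (2 * pi)) = 1"
      using cis_multiple_2pi[of "of_int k"] by (simp add: mult_ac)
    have "(LINT t|lborel. indicator {0..2*pi} t *\<^sub>R cis (of_int k * t)) = ?F (2*pi) - ?F 0"
      by (rule integral_FTC_Icc[OF _ d]) (auto intro!: continuous_intros simp: cis_conv_exp)
    also have "\<dots> = 0" using cis by simp
    finally show ?thesis unfolding * using False by simp
  qed
qed

section \<open>Square-integrable functions on the circle\<close>

lemma norm_add_square_le:
  fixes a b :: "'a::real_normed_vector"
  shows "(norm (a + b))\<^sup>2 \<le> 2 * (norm a)\<^sup>2 + 2 * (norm b)\<^sup>2"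
proof -
  have "(norm (a + b))\<^sup>2 \<le> (norm a + norm b)\<^sup>2"
    by (intro power_mono norm_triangle_ineq norm_ge_zero)
  also have "\<dots> \<le> 2 * (norm a)\<^sup>2 + 2 * (norm b)\<^sup>2"
    using zero_le_power2[of "norm a - norm b"] by (simp add: power2_eq_square algebra_simps)
  finally show ?thesis .
qed

lemma L2_circleD:
  assumes "f \<in> L2_circle"
  shows "f \<in> borel_measurable circle_measure" "integrable circle_measure (\<lambda>z. (cmod (f z))\<^sup>2)"
  using assms by (auto simp: L2_circle_def)

lemma L2_circle_add:
  assumes "f \<in> L2_circle" "g \<in> L2_circle"
  shows "(\<lambda>z. f z + g z) \<in> L2_circle"
proof -
  note [measurable] = assms[THEN L2_circleD(1)]
  have "integrable circle_measure (\<lambda>z. 2 * (cmod (f z))\<^sup>2 + 2 * (cmod (g z))\<^sup>2)"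
    using assms by (intro Bochner_Integration.integrable_add integrable_mult_right L2_circleD)
  then have "integrable circle_measure (\<lambda>z. (cmod (f z + g z))\<^sup>2)"
    by (rule Bochner_Integration.integrable_bound) (auto intro!: always_eventually norm_add_square_le)
  then show ?thesis by (simp add: L2_circle_def)
qed

lemma L2_circle_mult_bounded:
  assumes f: "f \<in> L2_circle" and [measurable]: "\<phi> \<in> borel_measurable circle_measure"
    and B: "AE z in circle_measure. cmod (\<phi> z) \<le> B"
  shows "(\<lambda>z. \<phi> z * f z) \<in> L2_circle"
proof -
  note [measurable] = L2_circleD(1)[OF f]
  have "integrable circle_measure (\<lambda>z. B\<^sup>2 * (cmod (f z))\<^sup>2)"
    using f by (intro integrable_mult_right L2_circleD)
  then have "integrable circle_measure (\<lambda>z. (cmod (\<phi> z * f z))\<^sup>2)"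
  proof (rule Bochner_Integration.integrable_bound)
    show "AE z in circle_measure. norm ((cmod (\<phi> z * f z))\<^sup>2) \<le> norm (B\<^sup>2 * (cmod (f z))\<^sup>2)"
      using B
    proof eventually_elim
      case (elim z)
      then have "(cmod (\<phi> z))\<^sup>2 \<le> B\<^sup>2" by (intro power_mono) auto
      then show ?case by (simp add: norm_mult power_mult_distrib mult_right_mono)
    qed
  qed measurable
  then show ?thesis by (simp add: L2_circle_def)
qed

lemma L2_circle_scale: "f \<in> L2_circle \<Longrightarrow> (\<lambda>z. c * f z) \<in> L2_circle"
  by (rule L2_circle_mult_bounded[where B = "cmod c"]) auto

lemma L2_circle_diff: "f \<in> L2_circle \<Longrightarrow> g \<in> L2_circle \<Longrightarrow> (\<lambda>z. f z - g z) \<in> L2_circle"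
  using L2_circle_add[of f "\<lambda>z. -1 * g z"] L2_circle_scale[of g "-1"] by simp

lemma L2_circle_AE_cong:
  assumes "f \<in> L2_circle" "g \<in> borel_measurable circle_measure" "AE z in circle_measure. g z = f z"
  shows "g \<in> L2_circle"
proof -
  note [measurable] = assms(2) L2_circleD(1)[OF assms(1)]
  have "integrable circle_measure (\<lambda>z. (cmod (f z))\<^sup>2) \<longleftrightarrow> integrable circle_measure (\<lambda>z. (cmod (g z))\<^sup>2)"
    by (rule integrable_cong_AE) (use assms(3) in auto)
  then show ?thesis using assms by (simp add: L2_circle_def)
qed

lemma continuous_imp_L2_circle:
  assumes "continuous_on (sphere 0 1) f"
  shows "f \<in> L2_circle"
  using assms
  by (auto simp: L2_circle_def
      intro!: continuous_measurable_circle continuous_integrable_circle continuous_intros)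

lemma integrable_mult_cnj:
  assumes "f \<in> L2_circle" "g \<in> L2_circle"
  shows "integrable circle_measure (\<lambda>z. f z * cnj (g z))"
proof -
  note [measurable] = assms[THEN L2_circleD(1)]
  have "integrable circle_measure (\<lambda>z. (cmod (f z))\<^sup>2 + (cmod (g z))\<^sup>2)"
    using assms by (intro Bochner_Integration.integrable_add L2_circleD)
  then show ?thesis
  proof (rule Bochner_Integration.integrable_bound)
    have "cmod (f z) * cmod (g z) \<le> (cmod (f z))\<^sup>2 + (cmod (g z))\<^sup>2" for z
      using sum_squares_bound[of "cmod (f z)" "cmod (g z)"]
        mult_nonneg_nonneg[OF norm_ge_zero[of "f z"] norm_ge_zero[of "g z"]] by linarith
    then show "AE z in circle_measure. norm (f z * cnj (g z)) \<le> norm ((cmod (f z))\<^sup>2 + (cmod (g z))\<^sup>2)"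
      by (simp add: norm_mult)
    have "cnj \<in> borel_measurable borel"
      by (intro borel_measurable_continuous_onI continuous_intros)
    then show "(\<lambda>z. f z * cnj (g z)) \<in> borel_measurable circle_measure"
      by measurable
  qed
qed

lemma L2_circle_integrable: "f \<in> L2_circle \<Longrightarrow> integrable circle_measure f"
  using integrable_mult_cnj[of f "\<lambda>_. 1"] continuous_imp_L2_circle[of "\<lambda>_. 1"] by simp

lemma L2_inner_commute: "L2_inner g f = cnj (L2_inner f g)"
  unfolding L2_inner_def
  using Bochner_Integration.integral_cnj[of circle_measure "\<lambda>z. f z * cnj (g z)"] by (simp add: mult.commute)

lemma L2_inner_diff_left:
  "f \<in> L2_circle \<Longrightarrow> g \<in> L2_circle \<Longrightarrow> h \<in> L2_circle \<Longrightarrow>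
    L2_inner (\<lambda>z. f z - g z) h = L2_inner f h - L2_inner g h"
  unfolding L2_inner_def left_diff_distrib by (intro Bochner_Integration.integral_diff integrable_mult_cnj)

lemma L2_inner_scale_left: "L2_inner (\<lambda>z. c * f z) h = c * L2_inner f h"
  unfolding L2_inner_def by (simp add: mult.assoc)

lemma L2_inner_scale_right: "L2_inner f (\<lambda>z. c * h z) = cnj c * L2_inner f h"
  unfolding L2_inner_def by (simp add: mult.left_commute)

lemma basis_map_L2_circle:
  assumes "\<And>i. v i \<in> L2_circle"
  shows "basis_map v x \<in> L2_circle"
proof -
  have "(\<lambda>z. \<Sum>i\<in>I. x $ i * v i z) \<in> L2_circle" if "finite I" for I
    using that
  proof induction
    case empty
    then show ?case by (simp add: continuous_imp_L2_circle)
  next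
    case (insert i I)
    then show ?case by (simp add: L2_circle_add L2_circle_scale assms)
  qed
  then show ?thesis unfolding basis_map_def by simp
qed

lemma L2_inner_basis_map_left:
  assumes v: "\<And>i. v i \<in> L2_circle" and h: "h \<in> L2_circle"
  shows "L2_inner (basis_map v x) h = (\<Sum>i\<in>UNIV. x $ i * L2_inner (v i) h)"
proof -
  have "L2_inner (basis_map v x) h = (LINT z|circle_measure. (\<Sum>i\<in>UNIV. x $ i * v i z * cnj (h z)))"
    unfolding L2_inner_def basis_map_def by (simp add: sum_distrib_right)
  also have "\<dots> = (\<Sum>i\<in>UNIV. LINT z|circle_measure. x $ i * v i z * cnj (h z))"
    by (intro Bochner_Integration.integral_sum integrable_mult_cnj L2_circle_scale v h)
  also have "\<dots> = (\<Sum>i\<in>UNIV. x $ i * L2_inner (v i) h)"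
    by (simp add: L2_inner_def mult.assoc)
  finally show ?thesis .
qed

lemma L2_inner_basis_map_right:
  assumes "\<And>i. v i \<in> L2_circle" and "h \<in> L2_circle"
  shows "L2_inner h (basis_map v x) = (\<Sum>i\<in>UNIV. cnj (x $ i) * L2_inner h (v i))"
  by (subst L2_inner_commute)
    (simp add: L2_inner_basis_map_left assms L2_inner_commute[of h "v _"])

lemma L2_eqD:
  assumes "L2_eq f g"
  shows "f \<in> L2_circle" "g \<in> L2_circle" "AE z in circle_measure. f z = g z"
  using assms by (auto simp: L2_eq_def)

lemma L2_eq_refl: "f \<in> L2_circle \<Longrightarrow> L2_eq f f"
  by (simp add: L2_eq_def)

lemma L2_eq_sym: "L2_eq f g \<Longrightarrow> L2_eq g f"
  by (auto simp: L2_eq_def eq_commute)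

lemma L2_eq_trans: "L2_eq f g \<Longrightarrow> L2_eq g h \<Longrightarrow> L2_eq f h"
  by (auto simp: L2_eq_def)

lemma L2_inner_cong:
  assumes f: "L2_eq f f'" and g: "L2_eq g g'"
  shows "L2_inner f g = L2_inner f' g'"
  unfolding L2_inner_def
proof (rule integral_cong_AE)
  show "AE z in circle_measure. f z * cnj (g z) = f' z * cnj (g' z)"
    using L2_eqD(3)[OF f] L2_eqD(3)[OF g] by eventually_elim simp
qed (intro borel_measurable_integrable integrable_mult_cnj L2_eqD[OF f] L2_eqD[OF g])+

lemma basis_map_cong:
  assumes "\<And>i. L2_eq (v i) (w i)"
  shows "L2_eq (basis_map v x) (basis_map w x)"
  unfolding L2_eq_def
proof (intro conjI basis_map_L2_circle)
  have "AE z in circle_measure. \<forall>i\<in>UNIV. v i z = w i z"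
    using assms by (intro AE_finite_allI) (auto dest: L2_eqD)
  then show "AE z in circle_measure. basis_map v x z = basis_map w x z"
    by eventually_elim (simp add: basis_map_def)
qed (use assms in \<open>auto dest: L2_eqD\<close>)

text \<open>
  A bound in \<open>L\<^sup>2\<close> gives uniform integrability, so pointwise convergence passes to the integrals although
  there is no common integrable majorant. This is what makes the almost everywhere radial limits in the
  definition of the Hardy space usable without maximal functions.
\<close>

lemma (in finite_measure) integral_tendsto_of_bounded_L2:
  fixes f :: "'a \<Rightarrow> 'b::{banach, second_countable_topology}"
  assumes meas: "\<And>m. s m \<in> borel_measurable M" "f \<in> borel_measurable M"
    and L2: "\<And>m. integrable M (\<lambda>x. (norm (s m x))\<^sup>2)" "integrable M (\<lambda>x. (norm (f x))\<^sup>2)"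
    and bound: "\<And>m. (LINT x|M. (norm (s m x))\<^sup>2) \<le> B"
    and lim: "AE x in M. (\<lambda>m. s m x) \<longlonglongrightarrow> f x"
  shows "(\<lambda>m. LINT x|M. s m x) \<longlonglongrightarrow> (LINT x|M. f x)"
proof -
  note [measurable] = meas
  define d where "d m x = norm (s m x - f x)" for m x
  have [measurable]: "d m \<in> borel_measurable M" for m
    unfolding d_def by measurable
  define C where "C = 2 * B + 2 * (LINT x|M. (norm (f x))\<^sup>2)"
  have int1: "integrable M g" if "g \<in> borel_measurable M" "integrable M (\<lambda>x. (norm (g x))\<^sup>2)"
    for g :: "'a \<Rightarrow> 'b"
  proof (rule Bochner_Integration.integrable_bound)
    show "integrable M (\<lambda>x. 1 + (norm (g x))\<^sup>2)"
      using that by (intro Bochner_Integration.integrable_add) auto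
    have "norm (g x) \<le> 1 + (norm (g x))\<^sup>2" for x
      using sum_squares_bound[of 1 "norm (g x)"] norm_ge_zero[of "g x"]
      by (simp only: one_power2 mult_1_right)
    then show "AE x in M. norm (g x) \<le> norm (1 + (norm (g x))\<^sup>2)" by simp
  qed (use that in simp)
  have ints: "integrable M (s m)" and intf: "integrable M f" for m
    using int1 meas L2 by blast+
  have intd: "integrable M (d m)" for m
    unfolding d_def by (intro integrable_norm Bochner_Integration.integrable_diff ints intf)
  have dle: "(d m x)\<^sup>2 \<le> 2 * (norm (s m x))\<^sup>2 + 2 * (norm (f x))\<^sup>2" for m x
    unfolding d_def using norm_add_square_le[of "s m x" "- f x"] by simp
  have intrhs: "integrable M (\<lambda>x. 2 * (norm (s m x))\<^sup>2 + 2 * (norm (f x))\<^sup>2)" for m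
    by (intro Bochner_Integration.integrable_add integrable_mult_right L2)
  have intd2: "integrable M (\<lambda>x. (d m x)\<^sup>2)" for m
    by (rule Bochner_Integration.integrable_bound[OF intrhs[of m]]) (use dle in auto)
  have d2: "(LINT x|M. (d m x)\<^sup>2) \<le> C" for m
  proof -
    have "(LINT x|M. (d m x)\<^sup>2) \<le> (LINT x|M. 2 * (norm (s m x))\<^sup>2 + 2 * (norm (f x))\<^sup>2)"
      by (intro integral_mono intd2 intrhs dle)
    also have "\<dots> \<le> C"
      using bound[of m] L2 by (simp add: C_def)
    finally show ?thesis .
  qed
  have lim0: "(\<lambda>m. LINT x|M. min (d m x) K) \<longlonglongrightarrow> 0" if "K > 0" for K
  proof -
    have "(\<lambda>m. LINT x|M. min (d m x) K) \<longlonglongrightarrow> (LINT x|M. 0)"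
    proof (rule integral_dominated_convergence[where w = "\<lambda>_. K"])
      show "AE x in M. (\<lambda>m. min (d m x) K) \<longlonglongrightarrow> 0"
        using lim
      proof eventually_elim
        case (elim x)
        have "(\<lambda>m. min (d m x) K) \<longlonglongrightarrow> min (norm (f x - f x)) K"
          unfolding d_def by (intro tendsto_intros elim)
        then show ?case using that by simp
      qed
      show "AE x in M. norm (min (d m x) K) \<le> K" for m
        using that by (auto simp: d_def)
    qed auto
    then show ?thesis by simp
  qed
  have "(\<lambda>m. LINT x|M. d m x) \<longlonglongrightarrow> 0"
  proof (rule LIMSEQ_I)
    fix e :: real assume e: "e > 0"
    \<comment> \<open>Chosen so that \<open>C / K < e / 2\<close>; the summand 1 covers the case \<open>C = 0\<close>.\<close>
    define K where "K = 2 * (\<bar>C\<bar> + 1) / e"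
    have K: "K > 0" using e by (simp add: K_def)
    have KC: "C / K < e / 2"
    proof -
      have "C / K \<le> \<bar>C\<bar> / K"
        using K by (intro divide_right_mono) auto
      also have "\<dots> = (\<bar>C\<bar> / (\<bar>C\<bar> + 1)) * (e / 2)"
        by (simp add: K_def)
      also have "\<dots> < 1 * (e / 2)"
        using e by (intro mult_strict_right_mono) auto
      finally show ?thesis by simp
    qed
    obtain N where N: "\<And>m. m \<ge> N \<Longrightarrow> \<bar>LINT x|M. min (d m x) K\<bar> < e / 2"
      using LIMSEQ_D[OF lim0[OF K], of "e/2"] e by auto
    have "norm ((LINT x|M. d m x) - 0) < e" if "m \<ge> N" for m
    proof -
      \<comment> \<open>Where \<open>d\<close> exceeds \<open>K\<close>, it is at most \<open>d\<^sup>2 / K\<close>.\<close>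
      have le: "d m x \<le> min (d m x) K + (d m x)\<^sup>2 / K" for x
      proof (cases "d m x \<le> K")
        case False
        then have "d m x * K \<le> d m x * d m x"
          using K by (intro mult_left_mono) auto
        then have "d m x \<le> (d m x)\<^sup>2 / K"
          using K by (simp add: power2_eq_square pos_le_divide_eq)
        then show ?thesis using False K by simp
      qed (use K in auto)
      have intm: "integrable M (\<lambda>x. min (d m x) K)"
        by (intro integrable_min intd) auto
      have "(LINT x|M. d m x) \<le> (LINT x|M. min (d m x) K + (d m x)\<^sup>2 / K)"
        by (rule integral_mono[OF intd _ le])
          (intro Bochner_Integration.integrable_add intm Bochner_Integration.integrable_divide_zero impI intd2)
      also have "\<dots> = (LINT x|M. min (d m x) K) + (LINT x|M. (d m x)\<^sup>2) / K"
        using intm intd2[of m] by (subst Bochner_Integration.integral_add) auto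
      also have "\<dots> \<le> (LINT x|M. min (d m x) K) + C / K"
        using d2[of m] K by (intro add_left_mono divide_right_mono) auto
      also have "\<dots> < e" using N[OF that] KC by linarith
      finally have "(LINT x|M. d m x) < e" .
      moreover have "0 \<le> (LINT x|M. d m x)"
        by (intro Bochner_Integration.integral_nonneg) (auto simp: d_def)
      ultimately show ?thesis by simp
    qed
    then show "\<exists>N. \<forall>m\<ge>N. norm ((LINT x|M. d m x) - 0) < e" by blast
  qed
  moreover have "\<forall>\<^sub>F m in sequentially.
      norm ((LINT x|M. s m x) - (LINT x|M. f x)) \<le> (LINT x|M. d m x)"
    unfolding d_def Bochner_Integration.integral_diff[OF ints intf, symmetric]
    by (intro always_eventually allI integral_norm_bound)
  ultimately have "(\<lambda>m. (LINT x|M. s m x) - (LINT x|M. f x)) \<longlonglongrightarrow> 0"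
    by (rule Lim_null_comparison[rotated])
  then show ?thesis by (rule LIM_zero_cancel)
qed

section \<open>Fourier coefficients of radial boundary values\<close>

text \<open>
  The witness \<open>F\<close> of membership in the Hardy space is kept explicit, because its Taylor coefficients are the
  Fourier coefficients of \<open>f\<close>.
\<close>

definition radial_boundary :: "(complex \<Rightarrow> complex) \<Rightarrow> (complex \<Rightarrow> complex) \<Rightarrow> bool" where
  "radial_boundary F f \<longleftrightarrow> F \<in> hardy_disc \<and> f \<in> L2_circle \<and>
     (AE z in circle_measure. ((\<lambda>r. F (of_real r * z)) \<longlongrightarrow> f z) (at_left (1::real)))"

lemma hardy_circle_iff: "f \<in> hardy_circle \<longleftrightarrow> (\<exists>F. radial_boundary F f)"
  by (auto simp: hardy_circle_def radial_boundary_def)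

definition disc_algebra :: "(complex \<Rightarrow> complex) set" where
  "disc_algebra = {G. continuous_on (cball 0 1) G \<and> G holomorphic_on ball 0 1}"

lemma disc_algebra_const [intro]: "(\<lambda>_. c) \<in> disc_algebra"
  by (simp add: disc_algebra_def)

lemma disc_algebra_poly [intro]: "poly p \<in> disc_algebra"
  by (auto simp: disc_algebra_def intro!: continuous_intros holomorphic_intros)

lemma disc_algebra_mult [intro]:
  "F \<in> disc_algebra \<Longrightarrow> G \<in> disc_algebra \<Longrightarrow> (\<lambda>z. F z * G z) \<in> disc_algebra"
  by (auto simp: disc_algebra_def intro!: continuous_intros holomorphic_intros)

lemma disc_algebra_divide [intro]:
  "F \<in> disc_algebra \<Longrightarrow> G \<in> disc_algebra \<Longrightarrow> (\<And>z. cmod z \<le> 1 \<Longrightarrow> G z \<noteq> 0) \<Longrightarrow>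
    (\<lambda>z. F z / G z) \<in> disc_algebra"
  by (auto simp: disc_algebra_def intro!: continuous_intros holomorphic_intros)

lemma disc_algebra_bounded:
  assumes "G \<in> disc_algebra"
  obtains B where "\<And>z. cmod z \<le> 1 \<Longrightarrow> cmod (G z) \<le> B"
proof -
  have "bounded (G ` cball 0 1)"
    using assms by (intro compact_imp_bounded compact_continuous_image) (auto simp: disc_algebra_def)
  then obtain B where "\<forall>x\<in>G ` cball 0 1. cmod x \<le> B"
    unfolding bounded_iff by blast
  then show ?thesis by (intro that[of B]) auto
qed

lemma disc_algebra_L2: "G \<in> disc_algebra \<Longrightarrow> G \<in> L2_circle"
  by (rule continuous_imp_L2_circle) (auto simp: disc_algebra_def intro: continuous_on_subset)

lemma disc_algebra_radial_limit:
  assumes G: "G \<in> disc_algebra" and z: "cmod z = 1"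
  shows "((\<lambda>r. G (of_real r * z)) \<longlongrightarrow> G z) (at_left (1::real))"
proof -
  have "continuous_on {0..1} (\<lambda>r::real. G (of_real r * z))"
    by (rule continuous_on_compose2[of "cball 0 1" G])
      (use G z in \<open>auto simp: disc_algebra_def norm_mult intro!: continuous_intros\<close>)
  then have "((\<lambda>r::real. G (of_real r * z)) \<longlongrightarrow> G (of_real 1 * z)) (at 1 within {0..1})"
    unfolding continuous_on_def by (rule bspec) simp
  moreover have "at 1 within {0..1} = at_left (1::real)"
    by (rule at_within_Icc_at_left) simp
  ultimately show ?thesis by simp
qed

lemma dilate_continuous_on:
  assumes "F holomorphic_on ball 0 1" "0 \<le> r" "r < 1"
  shows "continuous_on (sphere 0 1) (\<lambda>z. F (of_real r * z))"
  by (rule continuous_on_compose2[OF holomorphic_on_imp_continuous_on[OF assms(1)]])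
    (use assms in \<open>auto intro!: continuous_intros simp: norm_mult\<close>)

text \<open>
  Boundary values of Hardy functions form a module over the disc algebra. All multipliers needed below
  (polynomials, \<open>\<theta>\<close>, quotients by polynomials without zeros in the closed disc) lie in the disc algebra.
\<close>

lemma radial_boundary_mult:
  assumes F: "radial_boundary F f" and G: "G \<in> disc_algebra"
  shows "radial_boundary (\<lambda>z. F z * G z) (\<lambda>z. f z * G z)"
  unfolding radial_boundary_def
proof (intro conjI)
  obtain C where C: "\<And>z. cmod z \<le> 1 \<Longrightarrow> cmod (G z) \<le> C"
    using disc_algebra_bounded[OF G] by blast
  have Ghol: "G holomorphic_on ball 0 1" using G by (simp add: disc_algebra_def)
  have Fhol: "F holomorphic_on ball 0 1" using F by (simp add: radial_boundary_def hardy_disc_def)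
  obtain B where B: "\<And>r. 0 < r \<Longrightarrow> r < 1 \<Longrightarrow>
      (LINT z|circle_measure. (cmod (F (of_real r * z)))\<^sup>2) \<le> B"
    using F unfolding radial_boundary_def hardy_disc_def by fastforce
  have "(LINT z|circle_measure. (cmod (F (of_real r * z) * G (of_real r * z)))\<^sup>2) \<le> C\<^sup>2 * B"
    if r: "0 < r" "r < 1" for r
  proof -
    have "(LINT z|circle_measure. (cmod (F (of_real r * z) * G (of_real r * z)))\<^sup>2)
        \<le> (LINT z|circle_measure. C\<^sup>2 * (cmod (F (of_real r * z)))\<^sup>2)"
    proof (rule integral_mono)
      show "integrable circle_measure (\<lambda>z. (cmod (F (of_real r * z) * G (of_real r * z)))\<^sup>2)"
        "integrable circle_measure (\<lambda>z. C\<^sup>2 * (cmod (F (of_real r * z)))\<^sup>2)"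
        using r by (auto intro!: continuous_integrable_circle continuous_intros
            dilate_continuous_on[OF Fhol] dilate_continuous_on[OF Ghol])
      fix z assume "z \<in> space circle_measure"
      then have "cmod (G (of_real r * z)) \<le> C" using r by (intro C) (simp add: norm_mult)
      then have "(cmod (G (of_real r * z)))\<^sup>2 \<le> C\<^sup>2" by (intro power_mono) auto
      then show "(cmod (F (of_real r * z) * G (of_real r * z)))\<^sup>2 \<le> C\<^sup>2 * (cmod (F (of_real r * z)))\<^sup>2"
        by (simp add: norm_mult power_mult_distrib mult_left_mono mult.commute[of "C\<^sup>2"])
    qed
    also have "\<dots> = C\<^sup>2 * (LINT z|circle_measure. (cmod (F (of_real r * z)))\<^sup>2)" by simp
    also have "\<dots> \<le> C\<^sup>2 * B" by (intro mult_left_mono B r) auto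
    finally show ?thesis .
  qed
  then show "(\<lambda>z. F z * G z) \<in> hardy_disc"
    using Fhol Ghol by (auto simp: hardy_disc_def intro!: holomorphic_intros exI[of _ "C\<^sup>2 * B"])
  have "(\<lambda>z. G z * f z) \<in> L2_circle"
    using F G C disc_algebra_L2[OF G]
    by (intro L2_circle_mult_bounded[where B = C])
      (auto simp: radial_boundary_def L2_circleD intro!: AE_I2)
  then show "(\<lambda>z. f z * G z) \<in> L2_circle" by (simp add: mult.commute)
  have "AE z in circle_measure. ((\<lambda>r. F (of_real r * z)) \<longlongrightarrow> f z) (at_left (1::real))"
    using F by (simp add: radial_boundary_def)
  then show "AE z in circle_measure.
      ((\<lambda>r. F (of_real r * z) * G (of_real r * z)) \<longlongrightarrow> f z * G z) (at_left (1::real))"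
    using AE_space
    by eventually_elim (auto intro!: tendsto_mult disc_algebra_radial_limit[OF G])
qed

lemma radial_boundary_const: "radial_boundary (\<lambda>_. c) (\<lambda>_. c)"
  by (auto simp: radial_boundary_def hardy_disc_def intro!: continuous_imp_L2_circle)

lemma radial_boundary_disc_algebra: "G \<in> disc_algebra \<Longrightarrow> radial_boundary G G"
  using radial_boundary_mult[OF radial_boundary_const[of 1]] by simp

text \<open>
  The power series of \<open>F\<close> converges absolutely and uniformly on the circle of radius \<open>r < 1\<close> and may be
  integrated term by term against \<open>cnj z ^ k\<close>.
\<close>

lemma dilate_Fourier_coefficient:
  assumes F: "F holomorphic_on ball 0 1" and r: "0 \<le> r" "r < 1"
  shows "(LINT z|circle_measure. F (of_real r * z) * cnj z ^ k)
       = (deriv ^^ k) F 0 / fact k * of_real r ^ k"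
proof -
  define a where "a m = (deriv ^^ m) F 0 / fact m" for m
  have ps: "(\<lambda>m. a m * w ^ m) sums F w" if "cmod w < 1" for w
    using holomorphic_power_series[OF F, of w] that by (simp add: a_def)
  \<comment> \<open>The \<open>m\<close>-th term of the series for \<open>F (r * z) * cnj z ^ k\<close>, with \<open>cnj z = 1 / z\<close> on the circle.\<close>
  define h where "h m z = a m * of_real r ^ m * z powi (int m - int k)" for m and z :: complex
  have h: "h m z = a m * (of_real r * z) ^ m * cnj z ^ k" if "cmod z = 1" for m z
  proof -
    have "z \<noteq> 0" using that by auto
    moreover have "cnj z = inverse z"
      using that by (simp add: inverse_complex_def complex_eq_iff cmod_power2[symmetric])
    ultimately show ?thesis
      by (simp add: h_def power_int_diff power_mult_distrib divide_inverse power_inverse)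
  qed
  have hint: "(LINT z|circle_measure. h m z) = (if m = k then a k * of_real r ^ k else 0)" for m
    by (simp add: h_def integral_circle_int_power)
  have cont: "continuous_on (sphere 0 1) (h m)" for m
    unfolding h_def by (intro continuous_intros) auto
  have summ: "summable (\<lambda>m. cmod (a m) * r ^ m)"
  proof -
    obtain s where s: "r < s" "s < 1" using r dense by blast
    have "summable (\<lambda>m. a m * of_real s ^ m)"
      using ps[of "of_real s"] s r by (auto intro: sums_summable)
    then have "summable (\<lambda>m. norm (a m * of_real r ^ m))"
      by (rule powser_insidea) (use r s in auto)
    then show ?thesis using r by (simp add: norm_mult norm_power)
  qed
  have normh: "cmod (h m z) = cmod (a m) * r ^ m" if "cmod z = 1" for m z
    using that r by (simp add: h norm_mult norm_power)
  have "(\<lambda>m. LINT z|circle_measure. h m z) sums (LINT z|circle_measure. (\<Sum>m. h m z))"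
  proof (rule sums_integral)
    show "integrable circle_measure (h m)" for m
      by (rule continuous_integrable_circle[OF cont])
    show "AE z in circle_measure. summable (\<lambda>m. norm (h m z))"
      by (rule AE_I2) (simp add: normh summ)
    have "(LINT z|circle_measure. norm (h m z)) = measure circle_measure (sphere 0 1) * (cmod (a m) * r ^ m)" for m
    proof -
      have "(LINT z|circle_measure. norm (h m z)) = (LINT z|circle_measure. cmod (a m) * r ^ m)"
        by (rule Bochner_Integration.integral_cong) (auto simp: normh)
      then show ?thesis by simp
    qed
    then show "summable (\<lambda>m. LINT z|circle_measure. norm (h m z))"
      by (simp add: summable_mult summ)
  qed
  moreover have "(LINT z|circle_measure. (\<Sum>m. h m z)) = (LINT z|circle_measure. F (of_real r * z) * cnj z ^ k)"
  proof (rule Bochner_Integration.integral_cong)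
    fix z assume "z \<in> space circle_measure"
    then have z: "cmod z = 1" by simp
    have "(\<lambda>m. h m z) sums (F (of_real r * z) * cnj z ^ k)"
      unfolding h[OF z] by (rule sums_mult2[OF ps]) (use r z in \<open>simp add: norm_mult\<close>)
    then show "(\<Sum>m. h m z) = F (of_real r * z) * cnj z ^ k" by (rule sums_unique[symmetric])
  qed simp
  moreover have "(\<lambda>m. LINT z|circle_measure. h m z) sums (a k * of_real r ^ k)"
    unfolding hint using sums_single[of k "\<lambda>m. a m * of_real r ^ m"]
    by (simp add: if_distrib cong: if_cong)
  ultimately show ?thesis
    unfolding a_def[symmetric] by (metis sums_unique2)
qed

text \<open>
  Let \<open>r\<close> tend to 1 in the formula for the dilates of \<open>F\<close>: they are bounded in \<open>L\<^sup>2\<close> and converge to \<open>f\<close>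
  almost everywhere.
\<close>

lemma radial_boundary_Fourier_coefficient:
  assumes "radial_boundary F f"
  shows "(LINT z|circle_measure. f z * cnj z ^ k) = (deriv ^^ k) F 0 / fact k"
proof -
  have F: "F holomorphic_on ball 0 1" and f: "f \<in> L2_circle"
    and lim: "AE z in circle_measure. ((\<lambda>r. F (of_real r * z)) \<longlongrightarrow> f z) (at_left (1::real))"
    using assms by (auto simp: radial_boundary_def hardy_disc_def)
  obtain B where B: "\<And>r. 0 < r \<Longrightarrow> r < 1 \<Longrightarrow>
      (LINT z|circle_measure. (cmod (F (of_real r * z)))\<^sup>2) \<le> B"
    using assms unfolding radial_boundary_def hardy_disc_def by fastforce
  define \<rho> where "\<rho> m = 1 - inverse (real (m + 2))" for m
  have \<rho>: "0 < \<rho> m" "\<rho> m < 1" for m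
    by (auto simp: \<rho>_def field_simps)
  have "(\<lambda>m. inverse (real (m + 2))) \<longlonglongrightarrow> 0"
    using LIMSEQ_ignore_initial_segment[OF LIMSEQ_inverse_real_of_nat, of 1] by simp
  then have \<rho>1: "\<rho> \<longlonglongrightarrow> 1"
    unfolding \<rho>_def by (auto intro: tendsto_eq_intros)
  then have \<rho>left: "filterlim \<rho> (at_left 1) sequentially"
    unfolding filterlim_at using \<rho> by (auto intro!: always_eventually simp: less_imp_neq)
  have cm: "(\<lambda>z. cnj z ^ k) \<in> borel_measurable circle_measure"
    by (intro continuous_measurable_circle continuous_intros)
  have "(\<lambda>m. LINT z|circle_measure. F (of_real (\<rho> m) * z) * cnj z ^ k)
      \<longlonglongrightarrow> (LINT z|circle_measure. f z * cnj z ^ k)"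
  proof (rule circle.integral_tendsto_of_bounded_L2)
    have cont: "continuous_on (sphere 0 1) (\<lambda>z. F (of_real (\<rho> m) * z))" for m
      using \<rho>[of m] by (intro dilate_continuous_on F) auto
    show "(\<lambda>z. F (of_real (\<rho> m) * z) * cnj z ^ k) \<in> borel_measurable circle_measure"
      "integrable circle_measure (\<lambda>z. (cmod (F (of_real (\<rho> m) * z) * cnj z ^ k))\<^sup>2)" for m
      by (intro continuous_measurable_circle continuous_integrable_circle continuous_intros cont)+
    have "(\<lambda>z. cnj z ^ k * f z) \<in> L2_circle"
      by (rule L2_circle_mult_bounded[OF f cm, of 1]) (auto intro!: AE_I2 simp: norm_power)
    then show "(\<lambda>z. f z * cnj z ^ k) \<in> borel_measurable circle_measure"
      "integrable circle_measure (\<lambda>z. (cmod (f z * cnj z ^ k))\<^sup>2)"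
      by (auto simp: mult.commute dest: L2_circleD)
    show "(LINT z|circle_measure. (cmod (F (of_real (\<rho> m) * z) * cnj z ^ k))\<^sup>2) \<le> B" for m
    proof -
      have "(LINT z|circle_measure. (cmod (F (of_real (\<rho> m) * z) * cnj z ^ k))\<^sup>2)
          = (LINT z|circle_measure. (cmod (F (of_real (\<rho> m) * z)))\<^sup>2)"
        by (rule Bochner_Integration.integral_cong) (auto simp: norm_mult norm_power)
      then show ?thesis using B[OF \<rho>] by simp
    qed
    show "AE z in circle_measure. (\<lambda>m. F (of_real (\<rho> m) * z) * cnj z ^ k) \<longlonglongrightarrow> f z * cnj z ^ k"
      using lim by eventually_elim (intro tendsto_mult tendsto_const filterlim_compose[OF _ \<rho>left])
  qed
  moreover have "(\<lambda>m. LINT z|circle_measure. F (of_real (\<rho> m) * z) * cnj z ^ k)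
      \<longlonglongrightarrow> (deriv ^^ k) F 0 / fact k"
  proof -
    have "(LINT z|circle_measure. F (of_real (\<rho> m) * z) * cnj z ^ k)
        = (deriv ^^ k) F 0 / fact k * of_real (\<rho> m) ^ k" for m
      using \<rho>[of m] by (intro dilate_Fourier_coefficient F) auto
    moreover have "(\<lambda>m. (deriv ^^ k) F 0 / fact k * complex_of_real (\<rho> m) ^ k)
        \<longlonglongrightarrow> (deriv ^^ k) F 0 / fact k * of_real 1 ^ k"
      by (intro tendsto_intros \<rho>1)
    ultimately show ?thesis by simp
  qed
  ultimately show ?thesis by (rule LIMSEQ_unique)
qed

corollary radial_boundary_mean:
  "radial_boundary F f \<Longrightarrow> (LINT z|circle_measure. f z) = F 0"
  using radial_boundary_Fourier_coefficient[of F f 0] by simp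

section \<open>The model space of a finite Blaschke product\<close>

lemma unimodular_mult_cnj: "cmod z = 1 \<Longrightarrow> z * cnj z = 1"
  by (simp add: complex_norm_square[symmetric])

text \<open>
  Uniqueness of polynomial interpolation, which stands in for counting the dimension of the model space.
\<close>

lemma poly_eqI_many_roots:
  fixes p q :: "complex poly"
  assumes "inj_on \<eta> I" "degree p < card I" "degree q < card I"
    and "\<And>i. i \<in> I \<Longrightarrow> poly p (\<eta> i) = poly q (\<eta> i)"
  shows "p = q"
proof (rule ccontr)
  assume "p \<noteq> q"
  then have "p - q \<noteq> 0" by simp
  have "card I = card (\<eta> ` I)" by (simp add: assms(1) card_image)
  also have "\<dots> \<le> card {x. poly (p - q) x = 0}"
    by (rule card_mono[OF poly_roots_finite[OF \<open>p - q \<noteq> 0\<close>]]) (use assms(4) in auto)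
  also have "\<dots> \<le> degree (p - q)" by (rule card_poly_roots_bound[OF \<open>p - q \<noteq> 0\<close>])
  also have "\<dots> < card I" using assms by (intro degree_diff_less)
  finally show False by simp
qed

locale blaschke_product =
  fixes \<theta> :: "complex \<Rightarrow> complex" and n :: nat and c :: complex and a :: "nat \<Rightarrow> complex"
  assumes n_pos: "0 < n"
    and norm_c: "cmod c = 1"
    and norm_a: "j < n \<Longrightarrow> cmod (a j) < 1"
    and blaschke_eq: "cmod z \<le> 1 \<Longrightarrow> \<theta> z = c * (\<Prod>j<n. (z - a j) / (1 - cnj (a j) * z))"
begin

definition numer :: "complex poly" where "numer = (\<Prod>j<n. [:- a j, 1:])"
definition denom :: "complex poly" where "denom = (\<Prod>j<n. [:1, - cnj (a j):])"

lemma poly_numer: "poly numer z = (\<Prod>j<n. z - a j)"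
  by (simp add: numer_def poly_prod)

lemma poly_denom: "poly denom z = (\<Prod>j<n. 1 - cnj (a j) * z)"
  by (simp add: denom_def poly_prod mult.commute)

lemma degree_numer: "degree numer \<le> n"
  using degree_prod_sum_le[of "{..<n}" "\<lambda>j. [:- a j, 1:]"] by (simp add: numer_def)

lemma degree_denom: "degree denom \<le> n"
proof -
  have "degree denom \<le> (\<Sum>j<n. degree [:1, - cnj (a j):])"
    using degree_prod_sum_le[of "{..<n}" "\<lambda>j. [:1, - cnj (a j):]"] by (simp add: denom_def o_def)
  also have "\<dots> \<le> (\<Sum>j<n. 1)" by (intro sum_mono) simp
  finally show ?thesis by simp
qed

lemma denom_nonzero:
  assumes "cmod z \<le> 1"
  shows "poly denom z \<noteq> 0"
proof -
  have "1 - cnj (a j) * z \<noteq> 0" if "j < n" for j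
  proof
    assume "1 - cnj (a j) * z = 0"
    then have "cmod (a j) * cmod z = 1" by (metis complex_mod_cnj eq_iff_diff_eq_0 norm_mult norm_one)
    moreover have "cmod (a j) * cmod z \<le> cmod (a j)"
      using assms by (simp add: mult_left_le)
    ultimately show False using norm_a[OF that] by simp
  qed
  then show ?thesis by (simp add: poly_denom)
qed

lemma blaschke_quotient: "cmod z \<le> 1 \<Longrightarrow> \<theta> z = c * poly numer z / poly denom z"
  by (simp add: blaschke_eq poly_numer poly_denom prod_dividef)

text \<open>
  Since \<open>z * cnj z = 1\<close> on the circle, every factor satisfies \<open>z - a = z * cnj (1 - cnj a * z)\<close>. This
  identity turns conjugates of \<open>\<theta>\<close> into analytic expressions.
\<close>

lemma numer_reflect: "cmod z = 1 \<Longrightarrow> poly numer z = z ^ n * cnj (poly denom z)"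
proof -
  assume "cmod z = 1"
  then have "z - a j = z * cnj (1 - cnj (a j) * z)" for j
    using unimodular_mult_cnj[of z] by (simp add: algebra_simps)
  then have "(\<Prod>j<n. z - a j) = (\<Prod>j<n. z * cnj (1 - cnj (a j) * z))" by (rule prod.cong[OF refl])
  then show ?thesis by (simp add: poly_numer poly_denom prod.distrib)
qed

lemma blaschke_unimodular:
  assumes "cmod z = 1"
  shows "cmod (\<theta> z) = 1"
  using denom_nonzero[of z] assms norm_c
  by (simp add: blaschke_quotient numer_reflect norm_mult norm_divide norm_power)

lemma blaschke_disc_algebra: "\<theta> \<in> disc_algebra"
proof -
  have "(\<lambda>z. c * poly numer z / poly denom z) \<in> disc_algebra"
    by (intro disc_algebra_divide disc_algebra_mult disc_algebra_const disc_algebra_poly denom_nonzero)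
  moreover have "continuous_on (cball 0 1) \<theta> = continuous_on (cball 0 1) (\<lambda>z. c * poly numer z / poly denom z)"
    by (rule continuous_on_cong) (auto simp: blaschke_quotient)
  moreover have "\<theta> holomorphic_on ball 0 1 \<longleftrightarrow> (\<lambda>z. c * poly numer z / poly denom z) holomorphic_on ball 0 1"
    by (rule holomorphic_cong) (auto simp: blaschke_quotient)
  ultimately show ?thesis by (simp add: disc_algebra_def)
qed

definition model_fun :: "complex poly \<Rightarrow> complex \<Rightarrow> complex" where
  "model_fun p z = poly p z / poly denom z"

lemma model_fun_disc_algebra: "model_fun p \<in> disc_algebra"
  unfolding model_fun_def using denom_nonzero by blast

text \<open>
  The polynomial \<open>q\<close> is \<open>p\<close> with conjugated coefficients in reversed order. The factor \<open>z\<close> on the right, left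
  over because the degree of \<open>p\<close> is strictly below \<open>n\<close>, is what makes mean values vanish later.
\<close>

lemma poly_reflect:
  assumes "degree p < n"
  obtains q where "\<And>z. cmod z = 1 \<Longrightarrow> z ^ n * cnj (poly p z) = z * poly q z"
proof -
  define q where "q = (\<Sum>j<n. monom (cnj (coeff p j)) (n - Suc j))"
  have "z ^ n * cnj (poly p z) = z * poly q z" if z: "cmod z = 1" for z
  proof -
    have p: "poly p z = (\<Sum>j<n. coeff p j * z ^ j)"
      unfolding poly_altdef using assms
      by (intro sum.mono_neutral_left) (auto simp: coeff_eq_0)
    have "z ^ n * cnj (poly p z) = (\<Sum>j<n. z ^ n * (cnj (coeff p j) * cnj z ^ j))"
      unfolding p by (simp add: sum_distrib_left)
    also have "\<dots> = (\<Sum>j<n. z * (cnj (coeff p j) * z ^ (n - Suc j)))"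
    proof (rule sum.cong[OF refl])
      fix j assume "j \<in> {..<n}"
      then have "n = Suc (n - Suc j) + j" by simp
      then have "z ^ n = z * z ^ (n - Suc j) * z ^ j" by (metis power_Suc power_add)
      then have "z ^ n * cnj z ^ j = z * z ^ (n - Suc j) * (z * cnj z) ^ j"
        by (simp add: power_mult_distrib)
      then show "z ^ n * (cnj (coeff p j) * cnj z ^ j) = z * (cnj (coeff p j) * z ^ (n - Suc j))"
        by (simp add: unimodular_mult_cnj[OF z] mult_ac)
    qed
    also have "\<dots> = z * poly q z"
      by (simp add: q_def poly_sum poly_monom sum_distrib_left)
    finally show ?thesis .
  qed
  then show ?thesis by (rule that)
qed

text \<open>
  On the circle \<open>\<theta> * cnj (p / Q)\<close> equals \<open>c * z ^ n * cnj p / Q\<close>, which by reflection is analytic with a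
  zero at the origin. Its product with \<open>h\<close> then has mean value zero.
\<close>

lemma model_fun_orthogonal:
  assumes p: "degree p < n" and h: "h \<in> hardy_circle"
  shows "L2_inner (model_fun p) (\<lambda>z. \<theta> z * h z) = 0"
proof -
  obtain H where H: "radial_boundary H h" using h by (auto simp: hardy_circle_iff)
  obtain q where q: "\<And>z. cmod z = 1 \<Longrightarrow> z ^ n * cnj (poly p z) = z * poly q z"
    using poly_reflect[OF p] by blast
  define G where "G z = c * poly [:0, 1:] z * model_fun q z" for z
  have G: "G \<in> disc_algebra"
    unfolding G_def by (intro disc_algebra_mult disc_algebra_const disc_algebra_poly model_fun_disc_algebra)
  have "L2_inner (\<lambda>z. \<theta> z * h z) (model_fun p) = (LINT z|circle_measure. h z * G z)"
    unfolding L2_inner_def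
  proof (rule Bochner_Integration.integral_cong)
    fix z assume "z \<in> space circle_measure"
    then have z: "cmod z = 1" by simp
    have "cnj (poly denom z) \<noteq> 0" "poly denom z \<noteq> 0" using denom_nonzero[of z] z by auto
    then have "\<theta> z * cnj (model_fun p z) = c * (z ^ n * cnj (poly p z)) / poly denom z"
      using z by (simp add: blaschke_quotient numer_reflect model_fun_def)
    also have "\<dots> = G z" by (simp add: q[OF z] G_def model_fun_def)
    finally show "\<theta> z * h z * cnj (model_fun p z) = h z * G z" by (simp add: mult_ac)
  qed simp
  also have "\<dots> = H 0 * G 0" by (rule radial_boundary_mean[OF radial_boundary_mult[OF H G]])
  also have "\<dots> = 0" by (simp add: G_def)
  finally show ?thesis by (subst L2_inner_commute) simp
qed

text \<open>
  Testing \<open>f\<close> against \<open>\<theta> * Q * z ^ (k - n)\<close> gives the \<open>k\<close>-th Fourier coefficient of \<open>f * Q\<close> up to a unimodular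
  constant, since \<open>cnj P * z ^ n = Q\<close> on the circle. So the analytic extension of \<open>f * Q\<close> has a Taylor series
  that stops before degree \<open>n\<close>.
\<close>

lemma model_space_imp_model_fun:
  assumes f: "f \<in> model_space \<theta>"
  shows "\<exists>p. degree p < n \<and> (AE z in circle_measure. f z = model_fun p z)"
proof -
  obtain F where F: "radial_boundary F f"
    using f by (auto simp: model_space_def hardy_circle_iff)
  then have fL2: "f \<in> L2_circle" by (simp add: radial_boundary_def)
  \<comment> \<open>The function that turns out to be the polynomial numerator of \<open>f\<close>.\<close>
  define G where "G z = F z * poly denom z" for z
  have G: "radial_boundary G (\<lambda>z. f z * poly denom z)"
    unfolding G_def by (rule radial_boundary_mult[OF F disc_algebra_poly])
  have coef: "(deriv ^^ k) G 0 / fact k = 0" if "k \<ge> n" for k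
  proof -
    define h where "h z = poly (monom 1 (k - n) * denom) z" for z
    have "h \<in> hardy_circle"
      unfolding hardy_circle_iff h_def using radial_boundary_disc_algebra[OF disc_algebra_poly] by blast
    then have "L2_inner f (\<lambda>z. \<theta> z * h z) = 0"
      using f by (simp add: model_space_def)
    moreover have "L2_inner f (\<lambda>z. \<theta> z * h z)
        = (LINT z|circle_measure. cnj c * (f z * poly denom z * cnj z ^ k))"
      unfolding L2_inner_def
    proof (rule Bochner_Integration.integral_cong)
      fix z assume "z \<in> space circle_measure"
      then have z: "cmod z = 1" by simp
      have "\<theta> z * h z = c * (poly numer z * z ^ (k - n))"
        using denom_nonzero[of z] z by (simp add: blaschke_quotient h_def poly_monom)
      also have "poly numer z * z ^ (k - n) = cnj (poly denom z) * z ^ k"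
        using that by (simp add: numer_reflect[OF z] mult.commute mult.left_commute flip: power_add)
      finally show "f z * cnj (\<theta> z * h z) = cnj c * (f z * poly denom z * cnj z ^ k)"
        by (simp add: mult_ac)
    qed simp
    moreover have "c \<noteq> 0" using norm_c by auto
    ultimately have "(LINT z|circle_measure. f z * poly denom z * cnj z ^ k) = 0" by simp
    then show ?thesis using radial_boundary_Fourier_coefficient[OF G, of k] by simp
  qed
  define p where "p = (\<Sum>k<n. monom ((deriv ^^ k) G 0 / fact k) k)"
  have "degree p \<le> n - 1"
    unfolding p_def by (intro degree_sum_le) (auto intro: order.trans[OF degree_monom_le])
  then have deg: "degree p < n" using n_pos by simp
  have Gp: "G w = poly p w" if "cmod w < 1" for w
  proof -
    have "G holomorphic_on ball 0 1" using G by (simp add: radial_boundary_def hardy_disc_def)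
    then have "(\<lambda>k. (deriv ^^ k) G 0 / fact k * (w - 0) ^ k) sums G w"
      by (rule holomorphic_power_series) (use that in simp)
    moreover have "(\<lambda>k. (deriv ^^ k) G 0 / fact k * (w - 0) ^ k) sums
        (\<Sum>k<n. (deriv ^^ k) G 0 / fact k * (w - 0) ^ k)"
      by (rule sums_finite) (use coef in auto)
    ultimately have "G w = (\<Sum>k<n. (deriv ^^ k) G 0 / fact k * (w - 0) ^ k)" by (rule sums_unique2)
    then show ?thesis by (simp add: p_def poly_sum poly_monom)
  qed
  have "AE z in circle_measure. ((\<lambda>r. F (of_real r * z)) \<longlongrightarrow> f z) (at_left (1::real))"
    using F by (simp add: radial_boundary_def)
  then have "AE z in circle_measure. f z = model_fun p z"
    using AE_space
  proof eventually_elim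
    case (elim z)
    then have z: "cmod z = 1" by simp
    have "\<forall>\<^sub>F r in at_left (1::real). r \<in> {0<..<1}"
      by (rule eventually_at_leftI[of 0]) auto
    then have "\<forall>\<^sub>F r in at_left (1::real). model_fun p (of_real r * z) = F (of_real r * z)"
    proof eventually_elim
      case (elim r)
      then have "cmod (of_real r * z) < 1" using z by (simp add: norm_mult)
      then show ?case
        using Gp[of "of_real r * z"] denom_nonzero[of "of_real r * z"]
        by (simp add: model_fun_def G_def field_simps)
    qed
    moreover have "((\<lambda>r. model_fun p (of_real r * z)) \<longlongrightarrow> model_fun p z) (at_left (1::real))"
      by (rule disc_algebra_radial_limit[OF model_fun_disc_algebra z])
    ultimately have "((\<lambda>r. F (of_real r * z)) \<longlongrightarrow> model_fun p z) (at_left (1::real))"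
      by (rule Lim_transform_eventually[rotated])
    then show ?case using elim(1) tendsto_unique[OF trivial_limit_at_left_real] by blast
  qed
  then show ?thesis using deg by blast
qed

lemma model_space_iff:
  "f \<in> model_space \<theta> \<longleftrightarrow> (\<exists>p. degree p < n \<and> L2_eq f (model_fun p))"
proof
  assume f: "f \<in> model_space \<theta>"
  then have "f \<in> L2_circle" by (simp add: model_space_def hardy_circle_def)
  then show "\<exists>p. degree p < n \<and> L2_eq f (model_fun p)"
    using model_space_imp_model_fun[OF f] disc_algebra_L2[OF model_fun_disc_algebra]
    by (auto simp: L2_eq_def)
next
  assume "\<exists>p. degree p < n \<and> L2_eq f (model_fun p)"
  then obtain p where p: "degree p < n" and eq: "L2_eq f (model_fun p)" by blast
  have "radial_boundary (model_fun p) (model_fun p)"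
    by (rule radial_boundary_disc_algebra[OF model_fun_disc_algebra])
  then have "AE z in circle_measure. ((\<lambda>r. model_fun p (of_real r * z)) \<longlongrightarrow> model_fun p z) (at_left (1::real))"
    by (simp add: radial_boundary_def)
  then have "AE z in circle_measure. ((\<lambda>r. model_fun p (of_real r * z)) \<longlongrightarrow> f z) (at_left (1::real))"
    using L2_eqD(3)[OF eq] by eventually_elim simp
  then have "radial_boundary (model_fun p) f"
    using radial_boundary_disc_algebra[OF model_fun_disc_algebra, of p] L2_eqD(1)[OF eq]
    by (simp add: radial_boundary_def)
  then have "f \<in> hardy_circle" by (auto simp: hardy_circle_iff)
  moreover have "L2_inner f (\<lambda>z. \<theta> z * h z) = 0" if h: "h \<in> hardy_circle" for h
  proof -
    obtain H where "radial_boundary H h" using h by (auto simp: hardy_circle_iff)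
    from radial_boundary_mult[OF this blaschke_disc_algebra]
    have "(\<lambda>z. \<theta> z * h z) \<in> L2_circle" by (simp add: radial_boundary_def mult.commute)
    then have "L2_inner f (\<lambda>z. \<theta> z * h z) = L2_inner (model_fun p) (\<lambda>z. \<theta> z * h z)"
      by (rule L2_inner_cong[OF eq L2_eq_refl])
    then show ?thesis using model_fun_orthogonal[OF p h] by simp
  qed
  ultimately show "f \<in> model_space \<theta>" by (simp add: model_space_def)
qed

end

section \<open>Boundary kernels and the conjugation\<close>

text \<open>
  The circle measure has no atoms, so the value of a boundary kernel at its own point is irrelevant.
\<close>

lemma AE_circle_neq: "AE z in circle_measure. z \<noteq> \<eta>"
proof -
  have "t = Arg2pi \<eta>" if "t \<in> {0..<2*pi}" "cis t = \<eta>" for t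
    using Arg2pi_unique[of 1 t \<eta>] that by (simp add: cis_conv_exp)
  then have "AE t in lborel. t \<in> {0..<2*pi} \<longrightarrow> cis t \<noteq> \<eta>"
    using AE_lborel_singleton[of "Arg2pi \<eta>"] by auto
  then have "AE t in uniform_measure lborel {0..<2*pi}. cis t \<noteq> \<eta>"
    by (intro AE_uniform_measureI) auto
  moreover have "{z \<in> space (restrict_space borel (sphere 0 1)). z \<noteq> \<eta>} \<in> sets (restrict_space borel (sphere 0 1))"
  proof -
    have eq: "{z \<in> space (restrict_space borel (sphere 0 1)). z \<noteq> \<eta>} = sphere 0 1 \<inter> (- {\<eta>})"
      by (auto simp: space_restrict_space)
    have "- {\<eta>} \<in> sets borel" by simp
    then show ?thesis unfolding eq sets_restrict_space by (rule imageI)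
  qed
  ultimately show ?thesis
    unfolding circle_measure_def by (subst AE_distr_iff[OF cis_measurable_sphere])
qed

context blaschke_product
begin

lemma model_fun_linear_combination:
  assumes "\<And>i. L2_eq (v i) (model_fun (p i))"
  shows "L2_eq (basis_map v x) (model_fun (\<Sum>i\<in>UNIV. smult (x $ i) (p i)))"
proof -
  have "model_fun (\<Sum>i\<in>UNIV. smult (x $ i) (p i)) = basis_map (\<lambda>i. model_fun (p i)) x"
    by (simp add: fun_eq_iff basis_map_def model_fun_def poly_sum sum_divide_distrib)
  then show ?thesis using basis_map_cong[OF assms] by simp
qed

lemma model_space_basis_map:
  assumes "\<And>i. v i \<in> model_space \<theta>"
  shows "basis_map v x \<in> model_space \<theta>"
proof -
  from assms obtain p where p: "\<And>i. degree (p i) < n" "\<And>i. L2_eq (v i) (model_fun (p i))"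
    unfolding model_space_iff by metis
  have "degree (smult (x $ i) (p i)) \<le> n - 1" for i
    using degree_smult_le[of "x $ i" "p i"] p(1)[of i] by linarith
  then have "degree (\<Sum>i\<in>UNIV. smult (x $ i) (p i)) \<le> n - 1"
    by (intro degree_sum_le) auto
  then have "degree (\<Sum>i\<in>UNIV. smult (x $ i) (p i)) < n"
    using n_pos by simp
  then show ?thesis
    unfolding model_space_iff using model_fun_linear_combination[where v = v and p = p, OF p(2)] by blast
qed

lemma model_space_L2: "f \<in> model_space \<theta> \<Longrightarrow> f \<in> L2_circle"
  by (simp add: model_space_def hardy_circle_def)

lemma model_space_cong: "f \<in> model_space \<theta> \<Longrightarrow> L2_eq g f \<Longrightarrow> g \<in> model_space \<theta>"
  unfolding model_space_iff by (blast intro: L2_eq_trans)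

text \<open>
  Both \<open>Q - cnj (\<theta> \<eta>) * c * P\<close> and \<open>1 - cnj \<eta> * z\<close> vanish at \<open>\<eta>\<close>, and cancelling the common factor leaves a
  numerator of degree less than \<open>n\<close>. It is nonzero because the kernel does not vanish at the zero \<open>a 0\<close>
  of \<open>\<theta>\<close>.
\<close>

lemma boundary_kernel:
  assumes \<eta>: "cmod \<eta> = 1"
  shows "\<exists>K. degree K < n \<and> K \<noteq> 0 \<and>
    (\<forall>z. cmod z \<le> 1 \<longrightarrow> z \<noteq> \<eta> \<longrightarrow> model_kernel \<theta> \<eta> z = model_fun K z)"
proof -
  define R where "R = denom - smult (cnj (\<theta> \<eta>) * c) numer"
  have R: "poly R z = poly denom z * (1 - cnj (\<theta> \<eta>) * \<theta> z)" if "cmod z \<le> 1" for z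
    using denom_nonzero[OF that] by (simp add: R_def blaschke_quotient[OF that] field_simps)
  have "poly R \<eta> = 0"
    using unimodular_mult_cnj[OF blaschke_unimodular[OF \<eta>]] by (simp add: R \<eta> mult.commute)
  then obtain S where S: "R = [:- \<eta>, 1:] * S"
    by (auto simp: poly_eq_0_iff_dvd)
  have a0: "cmod (a 0) < 1" using norm_a n_pos by simp
  have "\<theta> (a 0) = 0"
    using a0 n_pos by (auto simp: blaschke_quotient poly_numer)
  then have Ra0: "poly R (a 0) \<noteq> 0"
    using a0 by (simp add: R denom_nonzero)
  then have "S \<noteq> 0" using S by auto
  have "degree R = Suc (degree S)"
    unfolding S using \<open>S \<noteq> 0\<close> by (subst degree_mult_eq) auto
  moreover have "degree R \<le> n"
    unfolding R_def using degree_numer degree_denom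
    by (intro degree_diff_le order.trans[OF degree_smult_le])
  ultimately have "degree S < n" by simp
  have eq: "model_kernel \<theta> \<eta> z = model_fun (smult (- \<eta>) S) z" if z: "cmod z \<le> 1" "z \<noteq> \<eta>" for z
  proof -
    have 1: "1 - cnj \<eta> * z = - cnj \<eta> * (z - \<eta>)"
      using unimodular_mult_cnj[OF \<eta>] by (simp add: algebra_simps)
    have "(1 - cnj (\<theta> \<eta>) * \<theta> z) = poly R z / poly denom z"
      using R[OF z(1)] denom_nonzero[OF z(1)] by simp
    also have "\<dots> = (z - \<eta>) * poly S z / poly denom z" by (simp add: S left_diff_distrib)
    finally have "model_kernel \<theta> \<eta> z = ((z - \<eta>) * poly S z / poly denom z) / (- cnj \<eta> * (z - \<eta>))"
      by (simp add: model_kernel_def 1)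
    also have "\<dots> = (poly S z / poly denom z) / (- cnj \<eta>)"
      using z(2) by simp
    also have "\<dots> = model_fun (smult (- \<eta>) S) z"
    proof -
      have "cnj \<eta> \<noteq> 0" using \<eta> by auto
      moreover have "- \<eta> * (- cnj \<eta>) = 1" using unimodular_mult_cnj[OF \<eta>] by simp
      ultimately have "inverse (- cnj \<eta>) = - \<eta>" by (metis inverse_unique mult.commute)
      then show ?thesis by (simp add: model_fun_def divide_inverse)
    qed
    finally show ?thesis .
  qed
  show ?thesis
    by (rule exI[of _ "smult (- \<eta>) S"]) (use \<open>degree S < n\<close> \<open>S \<noteq> 0\<close> \<eta> eq in auto)
qed

lemma model_kernel_measurable: "model_kernel \<theta> \<eta> \<in> borel_measurable circle_measure"
proof -
  have [measurable]: "\<theta> \<in> borel_measurable circle_measure"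
    using disc_algebra_L2[OF blaschke_disc_algebra] by (rule L2_circleD)
  have [measurable]: "(\<lambda>z. z) \<in> borel_measurable circle_measure"
    by (intro continuous_measurable_circle continuous_intros)
  show ?thesis unfolding model_kernel_def by measurable
qed

lemma model_kernel_L2_eq:
  assumes "\<And>z. cmod z \<le> 1 \<Longrightarrow> z \<noteq> \<eta> \<Longrightarrow> model_kernel \<theta> \<eta> z = model_fun K z"
  shows "L2_eq (model_kernel \<theta> \<eta>) (model_fun K)"
proof -
  have "AE z in circle_measure. model_kernel \<theta> \<eta> z = model_fun K z"
    using AE_circle_neq[of \<eta>] AE_space by eventually_elim (use assms in auto)
  moreover have K: "model_fun K \<in> L2_circle" by (rule disc_algebra_L2[OF model_fun_disc_algebra])
  ultimately show ?thesis
    unfolding L2_eq_def by (intro conjI L2_circle_AE_cong[OF K model_kernel_measurable])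
qed

text \<open>
  Write \<open>f z = f \<eta> + (z - \<eta>) * g z\<close>, where \<open>g\<close> is again in the model space. Because
  \<open>1 - \<eta> * cnj z = cnj z * (z - \<eta>)\<close> on the circle, the factor \<open>z - \<eta>\<close> cancels the denominator of the conjugated kernel.
  Every term that remains is integrated either by the mean value property or by orthogonality of \<open>f\<close> and
  \<open>g\<close> to \<open>\<theta>\<close>.
\<close>

lemma boundary_reproducing:
  assumes \<eta>: "cmod \<eta> = 1" and p: "degree p < n"
  shows "L2_inner (model_fun p) (model_kernel \<theta> \<eta>) = model_fun p \<eta>"
proof -
  obtain K where "degree K < n \<and> K \<noteq> 0 \<and>
      (\<forall>z. cmod z \<le> 1 \<longrightarrow> z \<noteq> \<eta> \<longrightarrow> model_kernel \<theta> \<eta> z = model_fun K z)"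
    using boundary_kernel[OF \<eta>] ..
  then have K: "model_kernel \<theta> \<eta> z = model_fun K z" if "cmod z \<le> 1" "z \<noteq> \<eta>" for z
    using that by simp
  define f where "f = model_fun p"
  define k where "k = model_fun K"
  have fa: "f \<in> disc_algebra" and ka: "k \<in> disc_algebra"
    by (simp_all add: f_def k_def model_fun_disc_algebra)
  have "poly (p - smult (f \<eta>) denom) \<eta> = 0"
    using denom_nonzero[of \<eta>] \<eta> by (simp add: f_def model_fun_def)
  then obtain q where q: "p - smult (f \<eta>) denom = [:- \<eta>, 1:] * q"
    unfolding poly_eq_0_iff_dvd dvd_def by (elim exE) (rule that)
  \<comment> \<open>The difference quotient of \<open>f\<close> at \<open>\<eta>\<close>; its numerator has lost one degree.\<close>
  define g where "g = model_fun q"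
  have ga: "g \<in> disc_algebra" by (simp add: g_def model_fun_disc_algebra)
  have degq: "degree q < n"
  proof (cases "q = 0")
    case False
    then have "Suc (degree q) = degree (p - smult (f \<eta>) denom)"
      unfolding q by (subst degree_mult_eq) auto
    also have "\<dots> \<le> n"
      using p degree_denom by (intro degree_diff_le order.trans[OF degree_smult_le]) auto
    finally show ?thesis by simp
  qed (use n_pos in simp)
  have split: "f z = f \<eta> + (z - \<eta>) * g z" if "cmod z \<le> 1" for z
  proof -
    have "poly p z - f \<eta> * poly denom z = (z - \<eta>) * poly q z"
      using arg_cong[OF q, of "\<lambda>r. poly r z"] by (simp add: algebra_simps)
    then show ?thesis
      using denom_nonzero[OF that] by (simp add: f_def g_def model_fun_def field_simps)
  qed
  define w where "w = \<theta> \<eta>"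
  have L2s: "f \<in> L2_circle" "g \<in> L2_circle" "\<theta> \<in> L2_circle" "k \<in> L2_circle" "(\<lambda>_. 1) \<in> L2_circle"
    using fa ga ka blaschke_disc_algebra by (auto intro: disc_algebra_L2)
  have ortho: "(LINT z|circle_measure. model_fun r z * cnj (\<theta> z)) = 0" if "degree r < n" for r
  proof -
    have "(\<lambda>_. 1) \<in> hardy_circle"
      unfolding hardy_circle_iff using radial_boundary_const by blast
    from model_fun_orthogonal[OF that this] show ?thesis by (simp add: L2_inner_def)
  qed
  have mean: "(LINT z|circle_measure. h z) = h 0" if "h \<in> disc_algebra" for h
    by (rule radial_boundary_mean[OF radial_boundary_disc_algebra[OF that]])
  have zg: "(\<lambda>z. z * g z) \<in> disc_algebra"
    using disc_algebra_mult[OF disc_algebra_poly[of "[:0,1:]"] ga] by simp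
  have i1: "integrable circle_measure (\<lambda>z. cnj (k z))"
    "integrable circle_measure (\<lambda>z. z * g z)"
    "integrable circle_measure (\<lambda>z. f z * cnj (\<theta> z))"
    "integrable circle_measure (\<lambda>z. cnj (\<theta> z))"
    "integrable circle_measure (\<lambda>z. g z * cnj (\<theta> z))"
    using L2s disc_algebra_L2[OF zg] integrable_mult_cnj[of f \<theta>] integrable_mult_cnj[of g \<theta>]
    by (auto intro: L2_circle_integrable)
  have "L2_inner f (model_kernel \<theta> \<eta>) = L2_inner f k"
    by (rule L2_inner_cong[OF L2_eq_refl[OF L2s(1)]])
      (use model_kernel_L2_eq[OF K] in \<open>simp add: k_def\<close>)
  also have "\<dots> = (LINT z|circle_measure. f \<eta> * cnj (k z) + z * g z - w * (f z * cnj (\<theta> z))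
      + w * f \<eta> * cnj (\<theta> z) - w * \<eta> * (g z * cnj (\<theta> z)))"
    unfolding L2_inner_def
  proof (rule integral_cong_AE)
    show "AE z in circle_measure. f z * cnj (k z) = f \<eta> * cnj (k z) + z * g z - w * (f z * cnj (\<theta> z))
      + w * f \<eta> * cnj (\<theta> z) - w * \<eta> * (g z * cnj (\<theta> z))"
      using AE_circle_neq[of \<eta>] AE_space
    proof eventually_elim
      case (elim z)
      then have z: "cmod z = 1" "z \<noteq> \<eta>" by auto
      have zz: "z * cnj z = 1" by (rule unimodular_mult_cnj[OF z(1)])
      have kz: "cnj (k z) = (1 - w * cnj (\<theta> z)) / (1 - \<eta> * cnj z)"
      proof -
        have "k z = model_kernel \<theta> \<eta> z" using K[of z] z by (simp add: k_def)
        then show ?thesis by (simp add: w_def model_kernel_def)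
      qed
      have kernel_denom: "z * (1 - \<eta> * cnj z) = z - \<eta>"
        using zz by (simp add: algebra_simps)
      then have "1 - \<eta> * cnj z \<noteq> 0" using z(2) by auto
      then have "(z - \<eta>) * cnj (k z) = z * (1 - w * cnj (\<theta> z))"
        unfolding kz kernel_denom[symmetric] by simp
      then have gk: "(z - \<eta>) * g z * cnj (k z) = z * g z * (1 - w * cnj (\<theta> z))"
        by (metis (no_types, opaque_lifting) mult.assoc mult.commute)
      have zg_eq: "z * g z = f z - f \<eta> + \<eta> * g z"
        using split[of z] z by (simp add: algebra_simps)
      have "f z * cnj (k z) = f \<eta> * cnj (k z) + (z - \<eta>) * g z * cnj (k z)"
        by (subst split) (simp_all add: z distrib_right)
      also have "\<dots> = f \<eta> * cnj (k z) + z * g z - w * (z * g z) * cnj (\<theta> z)"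
        unfolding gk by (simp add: right_diff_distrib)
      also have "w * (z * g z) * cnj (\<theta> z) = w * (f z - f \<eta> + \<eta> * g z) * cnj (\<theta> z)"
        by (simp only: zg_eq)
      finally show ?case by (simp add: algebra_simps)
    qed
    show "(\<lambda>z. f z * cnj (k z)) \<in> borel_measurable circle_measure"
      by (intro borel_measurable_integrable integrable_mult_cnj L2s)
    show "(\<lambda>z. f \<eta> * cnj (k z) + z * g z - w * (f z * cnj (\<theta> z))
      + w * f \<eta> * cnj (\<theta> z) - w * \<eta> * (g z * cnj (\<theta> z))) \<in> borel_measurable circle_measure"
      by (intro borel_measurable_integrable Bochner_Integration.integrable_add
          Bochner_Integration.integrable_diff integrable_mult_right i1)
  qed
  also have "\<dots> = f \<eta> * (LINT z|circle_measure. cnj (k z)) + (LINT z|circle_measure. z * g z)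
      - w * (LINT z|circle_measure. f z * cnj (\<theta> z)) + w * f \<eta> * (LINT z|circle_measure. cnj (\<theta> z))
      - w * \<eta> * (LINT z|circle_measure. g z * cnj (\<theta> z))"
    using i1 by (simp only: Bochner_Integration.integral_add Bochner_Integration.integral_diff
        Bochner_Integration.integral_mult_right_zero integrable_mult_right Bochner_Integration.integrable_add
        Bochner_Integration.integrable_diff simp_thms)
  also have "\<dots> = f \<eta> * cnj (k 0) + w * f \<eta> * cnj (\<theta> 0)"
    using ortho[OF p] ortho[OF degq] mean[OF ka] mean[OF zg] mean[OF blaschke_disc_algebra]
    by (simp add: f_def g_def)
  also have "\<dots> = f \<eta>"
  proof -
    have "k 0 = 1 - cnj w * \<theta> 0"
    proof -
      have "0 \<noteq> \<eta>" using \<eta> by auto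
      then show ?thesis using K[of 0] by (simp add: k_def w_def model_kernel_def)
    qed
    then have "cnj (k 0) = 1 - w * cnj (\<theta> 0)" by simp
    then show ?thesis by (simp add: right_diff_distrib)
  qed
  finally show ?thesis by (simp add: f_def)
qed

lemma model_conj_L2: 
  assumes "f \<in> L2_circle"
  shows "model_conj \<theta> f \<in> L2_circle"
proof -
  have "cnj \<in> borel_measurable borel"
    by (intro borel_measurable_continuous_onI continuous_intros)
  then have "(\<lambda>z. cnj (f z)) \<in> L2_circle"
    using assms measurable_compose[of f circle_measure borel cnj] by (auto simp: L2_circle_def)
  moreover have "continuous_on (sphere 0 1) \<theta>"
    using blaschke_disc_algebra by (auto simp: disc_algebra_def intro: continuous_on_subset)
  ultimately have "(\<lambda>z. (\<theta> z * cnj z) * cnj (f z)) \<in> L2_circle"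
    by (intro L2_circle_mult_bounded[where B = 1] continuous_measurable_circle AE_I2 continuous_intros)
      (auto simp: norm_mult blaschke_unimodular)
  then show ?thesis by (simp add: model_conj_def mult.assoc)
qed

lemma model_conj_cong:
  assumes "L2_eq f g"
  shows "L2_eq (model_conj \<theta> f) (model_conj \<theta> g)"
  using assms by (auto simp: L2_eq_def model_conj_L2) (auto simp: model_conj_def elim: eventually_mono)

text \<open>
  Multiplication by the unimodular function \<open>\<theta> * cnj z\<close> is isometric, and conjugation swaps the two
  arguments.
\<close>

lemma L2_inner_model_conj: "L2_inner (model_conj \<theta> f) (model_conj \<theta> g) = L2_inner g f"
  unfolding L2_inner_def
proof (rule Bochner_Integration.integral_cong)
  fix z assume "z \<in> space circle_measure"
  then have z: "cmod z = 1" by simp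
  have "model_conj \<theta> f z * cnj (model_conj \<theta> g z)
      = (\<theta> z * cnj (\<theta> z)) * (z * cnj z) * (g z * cnj (f z))"
    by (simp add: model_conj_def)
  then show "model_conj \<theta> f z * cnj (model_conj \<theta> g z) = g z * cnj (f z)"
    by (simp add: unimodular_mult_cnj z blaschke_unimodular)
qed simp

lemma C_real_basis_cong:
  assumes "C_real_basis \<theta> v" and eq: "\<And>i. L2_eq (u i) (v i)"
  shows "C_real_basis \<theta> u"
  unfolding C_real_basis_def
proof (intro conjI allI ballI)
  show "u i \<in> model_space \<theta>" for i
    using assms by (auto simp: C_real_basis_def intro: model_space_cong)
  show "L2_inner (u i) (u j) = (if i = j then 1 else 0)" for i j
    using assms L2_inner_cong[OF eq eq] by (simp add: C_real_basis_def)
  show "\<exists>x. L2_eq f (basis_map u x)" if "f \<in> model_space \<theta>" for f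
    using assms that basis_map_cong[of v u] L2_eq_sym[OF eq] L2_eq_trans
    unfolding C_real_basis_def by meson
  show "L2_eq (model_conj \<theta> (u i)) (u i)" for i
    using assms model_conj_cong[OF eq] L2_eq_trans L2_eq_sym[OF eq]
    unfolding C_real_basis_def by meson
qed

lemma clark_phase_square:
  assumes "cmod \<eta> = 1" "cmod w = 1"
  shows "cis ((Arg2pi (cnj \<eta>) + Arg2pi w) / 2) ^ 2 = cnj \<eta> * w"
proof -
  have "cis ((Arg2pi (cnj \<eta>) + Arg2pi w) / 2) ^ 2 = cis (Arg2pi (cnj \<eta>)) * cis (Arg2pi w)"
    by (simp add: power2_eq_square cis_mult)
  then show ?thesis
    using Arg2pi_eq[of "cnj \<eta>"] Arg2pi_eq[of w] assms by (simp add: cis_conv_exp)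
qed

text \<open>
  The conjugation maps \<open>k\<^sub>\<eta>\<close> to \<open>cnj \<eta> * w * k\<^sub>\<eta>\<close> with \<open>w = \<theta> \<eta>\<close>. The phase \<open>s\<close> of the Clark vector satisfies
  \<open>s\<^sup>2 = cnj \<eta> * w\<close>, so that \<open>cnj s * (cnj \<eta> * w) = s\<close>.
\<close>

lemma model_conj_clark_vector:
  assumes \<eta>: "cmod \<eta> = 1" and z: "cmod z = 1" "z \<noteq> \<eta>"
  shows "model_conj \<theta> (clark_vector \<theta> (\<theta> \<eta>) \<eta>) z = clark_vector \<theta> (\<theta> \<eta>) \<eta> z"
proof -
  define w where "w = \<theta> \<eta>"
  define s where "s = cis ((Arg2pi (cnj \<eta>) + Arg2pi w) / 2)"
  define N where "N = L2_norm (model_kernel \<theta> \<eta>)"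
  define k where "k = model_kernel \<theta> \<eta> z"
  note uni = unimodular_mult_cnj[OF \<eta>] unimodular_mult_cnj[OF z(1)]
    unimodular_mult_cnj[OF blaschke_unimodular[OF \<eta>], folded w_def]
    unimodular_mult_cnj[OF blaschke_unimodular[OF z(1)]]
  have "cmod w = 1" by (simp add: w_def blaschke_unimodular \<eta>)
  then have s2: "s * s = cnj \<eta> * w"
    using clark_phase_square[OF \<eta>, of w] by (simp add: s_def power2_eq_square)
  have ss: "s * cnj s = 1" by (rule unimodular_mult_cnj) (simp add: s_def)
  have d1: "1 - cnj \<eta> * z \<noteq> 0"
  proof
    assume "1 - cnj \<eta> * z = 0"
    then have "\<eta> = \<eta> * cnj \<eta> * z" by simp
    then show False using uni z(2) by simp
  qed
  then have d2: "1 - \<eta> * cnj z \<noteq> 0"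
    by (metis complex_cnj_cnj complex_cnj_diff complex_cnj_mult complex_cnj_one complex_cnj_zero)
  have "\<theta> z * cnj (z * k) = cnj \<eta> * w * k"
  proof -
    have "\<theta> z * cnj z * (1 - w * cnj (\<theta> z)) * (1 - cnj \<eta> * z)
        = (\<theta> z - w * (\<theta> z * cnj (\<theta> z))) * (cnj z - cnj \<eta> * (z * cnj z))"
      by (simp add: algebra_simps)
    also have "\<dots> = (w - w * cnj w * \<theta> z) * (cnj \<eta> - \<eta> * cnj \<eta> * cnj z)"
      unfolding uni by (simp add: algebra_simps)
    also have "\<dots> = cnj \<eta> * w * (1 - cnj w * \<theta> z) * (1 - \<eta> * cnj z)"
      by (simp add: algebra_simps)
    finally have "\<theta> z * cnj z * (1 - w * cnj (\<theta> z)) * (1 - cnj \<eta> * z)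
        = cnj \<eta> * w * (1 - cnj w * \<theta> z) * (1 - \<eta> * cnj z)" .
    then show ?thesis
      using d1 d2 by (simp add: k_def model_kernel_def w_def[symmetric] field_simps)
  qed
  then have "cnj s * (\<theta> z * cnj (z * k)) / N = cnj s * (s * s * k) / N"
    by (simp add: s2)
  also have "\<dots> = (s * cnj s) * (s * (k / N))" by simp
  finally have "\<theta> z * cnj (z * (s * (k / N))) = s * (k / N)"
    by (simp add: ss mult_ac)
  then show ?thesis
    unfolding model_conj_def clark_vector_def w_def[symmetric] s_def[symmetric] N_def[symmetric] k_def[symmetric] .
qed

end

section \<open>Clark bases and changes of basis\<close>

context blaschke_product
begin

text \<open>
  By the reproducing property the Gram matrix of the kernels has entries \<open>k\<^sub>i(\<eta>\<^sub>j)\<close>. It is diagonal since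
  \<open>1 - cnj w * \<theta>\<close> vanishes at every \<open>\<eta>\<^sub>j\<close>. A vanishing diagonal entry would give the numerator of \<open>k\<^sub>i\<close> the \<open>n\<close>
  roots \<open>\<eta>\<^sub>1, \<dots>, \<eta>\<^sub>n\<close>, which is more than its degree allows. Spanning is Lagrange interpolation with the
  numerators of the kernels in the role of the Lagrange polynomials.
\<close>

lemma clark_basis_is_C_real_basis:
  fixes \<eta> :: "'n::finite \<Rightarrow> complex"
  assumes n: "n = CARD('n)" and \<eta>: "bij_betw \<eta> UNIV {\<zeta> \<in> sphere 0 1. \<theta> \<zeta> = w}"
  shows "C_real_basis \<theta> (\<lambda>i. clark_vector \<theta> w (\<eta> i))"
proof -
  have norm_\<eta>: "cmod (\<eta> i) = 1" and \<theta>\<eta>: "\<theta> (\<eta> i) = w" for i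
    using bij_betwE[OF \<eta>] by auto
  have inj: "inj \<eta>" using \<eta> by (simp add: bij_betw_def)
  have "\<exists>K. \<forall>i. degree (K i) < n \<and> K i \<noteq> 0 \<and>
      (\<forall>z. cmod z \<le> 1 \<longrightarrow> z \<noteq> \<eta> i \<longrightarrow> model_kernel \<theta> (\<eta> i) z = model_fun (K i) z)"
    by (intro choice allI boundary_kernel norm_\<eta>)
  then obtain K where Kall: "\<forall>i. degree (K i) < n \<and> K i \<noteq> 0 \<and>
      (\<forall>z. cmod z \<le> 1 \<longrightarrow> z \<noteq> \<eta> i \<longrightarrow> model_kernel \<theta> (\<eta> i) z = model_fun (K i) z)" ..
  then have degK: "degree (K i) < n" and K0: "K i \<noteq> 0" for i by auto
  have K: "model_kernel \<theta> (\<eta> i) z = model_fun (K i) z" if "cmod z \<le> 1" "z \<noteq> \<eta> i" for i z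
    using Kall that by auto
  have Keq: "L2_eq (model_kernel \<theta> (\<eta> i)) (model_fun (K i))" for i
    by (rule model_kernel_L2_eq) (rule K)
  have uniw: "w * cnj w = 1"
    using unimodular_mult_cnj[OF blaschke_unimodular[OF norm_\<eta>]] by (simp add: \<theta>\<eta>)
  have off: "poly (K i) (\<eta> j) = 0" if "i \<noteq> j" for i j
  proof -
    have "\<eta> j \<noteq> \<eta> i" using inj that by (auto simp: inj_eq)
    then have "model_fun (K i) (\<eta> j) = model_kernel \<theta> (\<eta> i) (\<eta> j)"
      using K[of "\<eta> j" i] norm_\<eta> by simp
    then show ?thesis
      using denom_nonzero[of "\<eta> j"] norm_\<eta> uniw by (simp add: model_kernel_def model_fun_def \<theta>\<eta> mult.commute)
  qed
  have diag: "poly (K i) (\<eta> i) \<noteq> 0" for i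
  proof
    assume "poly (K i) (\<eta> i) = 0"
    then have "poly (K i) (\<eta> j) = poly 0 (\<eta> j)" for j
      using off[of i j] by (cases "i = j") auto
    then have "K i = 0"
      using inj degK[of i] n_pos n by (intro poly_eqI_many_roots[of \<eta> UNIV]) auto
    then show False using K0 by blast
  qed
  define N where "N i = L2_norm (model_kernel \<theta> (\<eta> i))" for i
  have gram: "L2_inner (model_kernel \<theta> (\<eta> i)) (model_kernel \<theta> (\<eta> j)) = model_fun (K i) (\<eta> j)" for i j
  proof -
    have "L2_inner (model_kernel \<theta> (\<eta> i)) (model_kernel \<theta> (\<eta> j))
        = L2_inner (model_fun (K i)) (model_kernel \<theta> (\<eta> j))"
      by (rule L2_inner_cong[OF Keq L2_eq_refl]) (rule L2_eqD(1)[OF Keq])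
    then show ?thesis by (simp add: boundary_reproducing norm_\<eta> degK)
  qed
  have N2: "of_real (N i) ^ 2 = model_fun (K i) (\<eta> i)" for i
  proof -
    have "L2_inner (model_kernel \<theta> (\<eta> i)) (model_kernel \<theta> (\<eta> i))
        = (LINT z|circle_measure. complex_of_real ((cmod (model_kernel \<theta> (\<eta> i) z))\<^sup>2))"
      unfolding L2_inner_def by (simp only: complex_norm_square)
    also have "\<dots> = of_real (LINT z|circle_measure. (cmod (model_kernel \<theta> (\<eta> i) z))\<^sup>2)"
      by (rule integral_complex_of_real)
    also have "\<dots> = of_real ((N i)\<^sup>2)"
      by (simp add: N_def L2_norm_def)
    finally show ?thesis using gram[of i i] by simp
  qed
  have N0: "N i \<noteq> 0" for i
    using N2[of i] diag[of i] denom_nonzero[of "\<eta> i"] norm_\<eta> by (auto simp: model_fun_def)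
  define s where "s i = cis ((Arg2pi (cnj (\<eta> i)) + Arg2pi w) / 2)" for i
  define d where "d i = s i / of_real (N i)" for i
  have ss: "s i * cnj (s i) = 1" for i by (rule unimodular_mult_cnj) (simp add: s_def)
  have d0: "d i \<noteq> 0" for i using N0[of i] by (simp add: d_def s_def)
  define e where "e i = clark_vector \<theta> w (\<eta> i)" for i
  have e: "e i = (\<lambda>z. d i * model_kernel \<theta> (\<eta> i) z)" for i
    by (simp add: e_def clark_vector_def d_def s_def N_def fun_eq_iff)
  have e_eq: "L2_eq (e i) (model_fun (smult (d i) (K i)))" for i
  proof -
    have "model_fun (smult (d i) (K i)) = (\<lambda>z. d i * model_fun (K i) z)"
      by (simp add: model_fun_def fun_eq_iff)
    then show ?thesis
      unfolding e using Keq[of i] L2_circle_scale by (auto simp: L2_eq_def elim: eventually_mono)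
  qed
  have eL2: "e i \<in> L2_circle" for i using e_eq by (rule L2_eqD)
  have "C_real_basis \<theta> e"
    unfolding C_real_basis_def
  proof (intro conjI allI ballI)
    show "e i \<in> model_space \<theta>" for i
      unfolding model_space_iff using e_eq[of i] degK[of i] le_less_trans[OF degree_smult_le] by blast
    show "L2_inner (e i) (e j) = (if i = j then 1 else 0)" for i j
    proof -
      have "L2_inner (e i) (e j) = d i * cnj (d j) * model_fun (K i) (\<eta> j)"
        unfolding e by (simp add: L2_inner_scale_left L2_inner_scale_right gram)
      also have "\<dots> = (if i = j then 1 else 0)"
      proof (cases "i = j")
        case True
        have "d i * cnj (d i) * of_real (N i) ^ 2 = s i * cnj (s i)"
          using N0[of i] by (simp add: d_def power2_eq_square)
        then show ?thesis using True ss[of i] N2[of i] by simp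
      qed (simp add: off model_fun_def)
      finally show ?thesis .
    qed
    show "\<exists>x. L2_eq f (basis_map e x)" if "f \<in> model_space \<theta>" for f
    proof -
      from that obtain p where p: "degree p < n" "L2_eq f (model_fun p)"
        by (auto simp: model_space_iff)
      \<comment> \<open>The Lagrange coefficients: at \<open>\<eta> i\<close> only the \<open>i\<close>-th numerator is nonzero.\<close>
      define x where "x = (\<chi> i. poly p (\<eta> i) / (d i * poly (K i) (\<eta> i)))"
      define r where "r = (\<Sum>i\<in>UNIV. smult (x $ i) (smult (d i) (K i)))"
      have "poly p (\<eta> j) = poly r (\<eta> j)" for j
      proof -
        have "poly r (\<eta> j) = (\<Sum>i\<in>UNIV. if i = j then poly p (\<eta> j) else 0)"
          unfolding r_def poly_sum using off d0 diag by (intro sum.cong) (auto simp: x_def)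
        then show ?thesis by simp
      qed
      moreover have "degree r < n"
      proof -
        have "degree (smult (x $ i) (smult (d i) (K i))) \<le> n - 1" for i
          using degK[of i] degree_smult_le[of "x $ i" "smult (d i) (K i)"]
            degree_smult_le[of "d i" "K i"] by linarith
        then have "degree r \<le> n - 1" unfolding r_def by (intro degree_sum_le) auto
        then show ?thesis using n_pos by simp
      qed
      ultimately have "p = r"
        using inj p(1) n by (intro poly_eqI_many_roots[of \<eta> UNIV]) auto
      then have "L2_eq (basis_map e x) (model_fun p)"
        unfolding r_def using model_fun_linear_combination[of e, OF e_eq] by simp
      then show ?thesis using p(2) L2_eq_sym L2_eq_trans by blast
    qed
    show "L2_eq (model_conj \<theta> (e i)) (e i)" for i
    proof -
      have "AE z in circle_measure. model_conj \<theta> (e i) z = e i z"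
        using AE_circle_neq[of "\<eta> i"] AE_space
        by eventually_elim
          (use model_conj_clark_vector[OF norm_\<eta>[of i]] in \<open>simp add: e_def \<theta>\<eta>\<close>)
      then show ?thesis by (simp add: L2_eq_def model_conj_L2 eL2)
    qed
  qed
  then show ?thesis by (simp add: e_def[abs_def])
qed

lemma modified_clark_basis_is_C_real_basis:
  fixes cb :: "'n::finite \<Rightarrow> complex \<Rightarrow> complex"
  assumes "n = CARD('n)" "modified_clark_basis \<theta> cb"
  shows "C_real_basis \<theta> cb"
proof -
  obtain w \<eta> where "bij_betw \<eta> (UNIV :: 'n set) {\<zeta> \<in> sphere 0 1. \<theta> \<zeta> = w}"
    and cb: "\<And>i. L2_eq (cb i) (clark_vector \<theta> w (\<eta> i))"
    using assms(2) unfolding modified_clark_basis_def by blast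
  then show ?thesis
    using C_real_basis_cong[OF clark_basis_is_C_real_basis[OF assms(1)]] by blast
qed

lemma C_real_basisD:
  assumes "C_real_basis \<theta> u"
  shows "u i \<in> model_space \<theta>" "u i \<in> L2_circle"
    "L2_inner (u i) (u j) = (if i = j then 1 else 0)"
    "f \<in> model_space \<theta> \<Longrightarrow> \<exists>x. L2_eq f (basis_map u x)"
    "L2_eq (model_conj \<theta> (u i)) (u i)"
  using assms by (auto simp: C_real_basis_def model_space_L2)

lemma L2_inner_basis_map_basis_map:
  fixes u :: "'n::finite \<Rightarrow> complex \<Rightarrow> complex"
  assumes u: "C_real_basis \<theta> u"
  shows "L2_inner (basis_map u x) (basis_map u y) = (\<Sum>i\<in>UNIV. x $ i * cnj (y $ i))"
proof -
  note L2 = C_real_basisD(2)[OF u]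
  have "L2_inner (basis_map u x) (basis_map u y)
      = (\<Sum>i\<in>UNIV. x $ i * (\<Sum>j\<in>UNIV. cnj (y $ j) * (if i = j then 1 else 0)))"
    by (subst L2_inner_basis_map_left)
      (simp_all add: L2_inner_basis_map_right basis_map_L2_circle L2 C_real_basisD(3)[OF u])
  also have "\<dots> = (\<Sum>i\<in>UNIV. x $ i * cnj (y $ i))"
    by (simp add: if_distrib cong: if_cong)
  finally show ?thesis .
qed

lemma C_real_basis_coordinate:
  fixes u :: "'n::finite \<Rightarrow> complex \<Rightarrow> complex"
  assumes u: "C_real_basis \<theta> u" and eq: "L2_eq f (basis_map u x)"
  shows "L2_inner f (u i) = x $ i"
proof -
  note L2 = C_real_basisD(2)[OF u]
  have "L2_inner f (u i) = L2_inner (basis_map u x) (u i)"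
    by (rule L2_inner_cong[OF eq L2_eq_refl[OF L2]])
  also have "\<dots> = (\<Sum>j\<in>UNIV. x $ j * (if j = i then 1 else 0))"
    by (simp add: L2_inner_basis_map_left L2 C_real_basisD(3)[OF u])
  also have "\<dots> = x $ i" by (simp add: if_distrib cong: if_cong)
  finally show ?thesis .
qed

end

lemma complex_matrix_column:
  fixes U :: "real ^ 'n ^ 'n"
  shows "(complex_matrix U *v axis j 1) $ i = complex_of_real (U $ i $ j)"
  by (simp add: matrix_vector_mult_def axis_def if_distrib cong: if_cong)

lemma orthogonal_matrix_transpose_entries:
  fixes U :: "real ^ 'n ^ 'n"
  assumes "orthogonal_matrix U"
  shows "(\<Sum>i\<in>UNIV. U $ i $ j * U $ i $ k) = (if j = k then 1 else 0)"
    and "(\<Sum>i\<in>UNIV. U $ j $ i * U $ k $ i) = (if j = k then 1 else 0)"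
proof -
  have "transpose U ** U = mat 1" "U ** transpose U = mat 1"
    using assms by (auto simp: orthogonal_matrix_def)
  then have "(transpose U ** U) $ j $ k = mat 1 $ j $ k" "(U ** transpose U) $ j $ k = mat 1 $ j $ k"
    by simp_all
  then show "(\<Sum>i\<in>UNIV. U $ i $ j * U $ i $ k) = (if j = k then 1 else 0)"
    "(\<Sum>i\<in>UNIV. U $ j $ i * U $ k $ i) = (if j = k then 1 else 0)"
    by (simp_all add: matrix_matrix_mult_def transpose_def mat_def)
qed

lemma complex_matrix_transpose_inverse:
  fixes U :: "real ^ 'n ^ 'n"
  assumes "orthogonal_matrix U"
  shows "transpose (complex_matrix U) ** complex_matrix U = mat 1"
    and "complex_matrix U ** transpose (complex_matrix U) = mat 1"
  using orthogonal_matrix_transpose_entries[OF assms]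
  by (simp_all add: matrix_matrix_mult_def transpose_def mat_def vec_eq_iff flip: of_real_mult of_real_sum)

lemma matrix_inv_complex_matrix:
  assumes U: "orthogonal_matrix (U :: real ^ 'n ^ 'n)"
  shows "matrix_inv (complex_matrix U) = transpose (complex_matrix U)"
proof -
  let ?C = "complex_matrix U"
  have "?C ** matrix_inv ?C = mat 1 \<and> matrix_inv ?C ** ?C = mat 1"
    unfolding matrix_inv_def
    by (rule someI[of _ "transpose ?C"]) (simp add: complex_matrix_transpose_inverse[OF U])
  then have "matrix_inv ?C = matrix_inv ?C ** (?C ** transpose ?C)"
    by (simp add: complex_matrix_transpose_inverse[OF U])
  also have "\<dots> = transpose ?C"
    using \<open>?C ** matrix_inv ?C = mat 1 \<and> matrix_inv ?C ** ?C = mat 1\<close> by (simp add: matrix_mul_assoc)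
  finally show ?thesis .
qed

lemma basis_map_matrix_columns:
  fixes M :: "complex ^ 'n ^ 'n"
  shows "basis_map (\<lambda>j. basis_map u (M *v axis j 1)) y = basis_map u (M *v y)"
proof
  fix z
  have col: "(M *v axis j 1) $ i = M $ i $ j" for i j
    by (simp add: matrix_vector_mult_def axis_def if_distrib cong: if_cong)
  have "basis_map (\<lambda>j. basis_map u (M *v axis j 1)) y z
      = (\<Sum>j\<in>UNIV. \<Sum>i\<in>UNIV. M $ i $ j * y $ j * u i z)"
    by (simp add: basis_map_def col sum_distrib_left mult_ac)
  also have "\<dots> = (\<Sum>i\<in>UNIV. \<Sum>j\<in>UNIV. M $ i $ j * y $ j * u i z)"
    by (rule sum.swap)
  also have "\<dots> = basis_map u (M *v y) z"
    by (simp add: basis_map_def matrix_vector_mult_def sum_distrib_right)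
  finally show "basis_map (\<lambda>j. basis_map u (M *v axis j 1)) y z = basis_map u (M *v y) z" .
qed

context blaschke_product
begin

text \<open>
  The coefficients \<open>\<langle>v\<^sub>j, u\<^sub>i\<rangle>\<close> equal \<open>\<langle>C v\<^sub>j, C u\<^sub>i\<rangle> = \<langle>u\<^sub>i, v\<^sub>j\<rangle>\<close> and are therefore real.
\<close>

lemma C_real_basis_change:
  fixes u v :: "'n::finite \<Rightarrow> complex \<Rightarrow> complex"
  assumes v: "C_real_basis \<theta> v" and u: "C_real_basis \<theta> u"
  shows "\<exists>U :: real ^ 'n ^ 'n. orthogonal_matrix U \<and>
    (\<forall>j. L2_eq (v j) (basis_map u (complex_matrix U *v axis j 1)))"
proof -
  have "\<exists>x. \<forall>j. L2_eq (v j) (basis_map u (x j))"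
    by (intro choice allI C_real_basisD(4)[OF u] C_real_basisD(1)[OF v])
  then obtain x where x: "\<And>j. L2_eq (v j) (basis_map u (x j))" by blast
  have coord: "L2_inner (v j) (u i) = x j $ i" for i j
    by (rule C_real_basis_coordinate[OF u x])
  have "cnj (x j $ i) = x j $ i" for i j
  proof -
    have "L2_inner (v j) (u i) = L2_inner (model_conj \<theta> (v j)) (model_conj \<theta> (u i))"
      by (rule L2_inner_cong[OF L2_eq_sym L2_eq_sym]) (rule C_real_basisD(5)[OF v] C_real_basisD(5)[OF u])+
    also have "\<dots> = L2_inner (u i) (v j)" by (rule L2_inner_model_conj)
    also have "\<dots> = cnj (L2_inner (v j) (u i))" by (rule L2_inner_commute)
    finally show ?thesis by (simp add: coord)
  qed
  then have real: "of_real (Re (x j $ i)) = x j $ i" for i j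
    by (simp add: complex_eq_iff)
  define U :: "real ^ 'n ^ 'n" where "U = (\<chi> i j. Re (x j $ i))"
  have xU: "x j = complex_matrix U *v axis j 1" for j
    by (simp add: vec_eq_iff complex_matrix_column U_def real)
  have "transpose U ** U = mat 1"
  proof -
    have "(\<Sum>i\<in>UNIV. U $ i $ j * U $ i $ k) = (if j = k then 1 else 0)" for j k
    proof -
      have "complex_of_real (\<Sum>i\<in>UNIV. U $ i $ j * U $ i $ k) = (\<Sum>i\<in>UNIV. x j $ i * cnj (x k $ i))"
        by (simp add: xU complex_matrix_column)
      also have "\<dots> = L2_inner (basis_map u (x j)) (basis_map u (x k))"
        by (simp add: L2_inner_basis_map_basis_map[OF u])
      also have "\<dots> = L2_inner (v j) (v k)"
        by (rule L2_inner_cong[symmetric, OF x x])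
      also have "\<dots> = complex_of_real (if j = k then 1 else 0)"
        by (simp add: C_real_basisD(3)[OF v])
      finally show ?thesis by (simp only: of_real_eq_iff)
    qed
    then show ?thesis
      by (simp add: matrix_matrix_mult_def transpose_def mat_def vec_eq_iff)
  qed
  then have "orthogonal_matrix U" by (simp add: orthogonal_matrix)
  then show ?thesis using x by (auto simp: xU)
qed

text \<open>
  The coefficients of the new vectors are real, so the antilinear conjugation acts on the basis vectors only.
\<close>

lemma C_real_basis_orthogonal_image:
  fixes u :: "'n::finite \<Rightarrow> complex \<Rightarrow> complex"
  assumes u: "C_real_basis \<theta> u" and U: "orthogonal_matrix (U :: real ^ 'n ^ 'n)"
  shows "C_real_basis \<theta> (\<lambda>j. basis_map u (complex_matrix U *v axis j 1))"
  unfolding C_real_basis_def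
proof (intro conjI allI ballI)
  let ?v = "\<lambda>j. basis_map u (complex_matrix U *v axis j 1)"
  show "?v j \<in> model_space \<theta>" for j
    by (intro model_space_basis_map C_real_basisD(1)[OF u])
  show "L2_inner (?v j) (?v k) = (if j = k then 1 else 0)" for j k
  proof -
    have "L2_inner (?v j) (?v k) = complex_of_real (\<Sum>i\<in>UNIV. U $ i $ j * U $ i $ k)"
      by (simp add: L2_inner_basis_map_basis_map[OF u] complex_matrix_column)
    then show ?thesis by (simp add: orthogonal_matrix_transpose_entries[OF U])
  qed
  show "\<exists>x. L2_eq f (basis_map ?v x)" if f: "f \<in> model_space \<theta>" for f
  proof -
    obtain x where x: "L2_eq f (basis_map u x)" using C_real_basisD(4)[OF u f] by blast
    have "basis_map ?v (transpose (complex_matrix U) *v x) = basis_map u x"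
      by (simp only: basis_map_matrix_columns matrix_vector_mul_assoc
          complex_matrix_transpose_inverse[OF U] matrix_vector_mul_lid)
    then show ?thesis using x by metis
  qed
  show "L2_eq (model_conj \<theta> (?v j)) (?v j)" for j
  proof -
    have "model_conj \<theta> (?v j) = basis_map (\<lambda>i. model_conj \<theta> (u i)) (complex_matrix U *v axis j 1)"
      by (simp add: fun_eq_iff basis_map_def model_conj_def complex_matrix_column sum_distrib_left mult_ac)
    then show ?thesis using basis_map_cong[OF C_real_basisD(5)[OF u]] by simp
  qed
qed

text \<open>
  With a finite orthonormal basis at hand, the projection is given by the Fourier expansion. Its existence is
  what the choice in \<open>model_proj\<close> rests on.
\<close>

lemma model_proj_exists:
  fixes u :: "'n::finite \<Rightarrow> complex \<Rightarrow> complex"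
  assumes u: "C_real_basis \<theta> u" and g: "g \<in> L2_circle"
  shows "\<exists>p. p \<in> model_space \<theta> \<and> (\<forall>f\<in>model_space \<theta>. L2_inner (\<lambda>z. g z - p z) f = 0)"
proof (intro exI conjI ballI)
  let ?p = "basis_map u (\<chi> i. L2_inner g (u i))"
  show p: "?p \<in> model_space \<theta>"
    by (intro model_space_basis_map C_real_basisD(1)[OF u])
  fix f assume "f \<in> model_space \<theta>"
  then obtain x where x: "L2_eq f (basis_map u x)" using C_real_basisD(4)[OF u] by blast
  have gp: "(\<lambda>z. g z - ?p z) \<in> L2_circle" by (rule L2_circle_diff[OF g model_space_L2[OF p]])
  have "L2_inner (\<lambda>z. g z - ?p z) (u i) = 0" for i
    using C_real_basis_coordinate[OF u L2_eq_refl[OF model_space_L2[OF p]], of i]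
    by (simp add: L2_inner_diff_left g model_space_L2[OF p] C_real_basisD(2)[OF u])
  then have "L2_inner (\<lambda>z. g z - ?p z) (basis_map u x) = 0"
    by (simp add: L2_inner_basis_map_right C_real_basisD(2)[OF u] gp)
  then show "L2_inner (\<lambda>z. g z - ?p z) f = 0"
    using L2_inner_cong[OF L2_eq_refl[OF gp] x] by simp
qed

text \<open>
  The projection is invisible when the result is paired with an element of the model space.
\<close>

lemma L2_inner_truncated_toeplitz:
  fixes u :: "'n::finite \<Rightarrow> complex \<Rightarrow> complex"
  assumes u: "C_real_basis \<theta> u" and A: "truncated_toeplitz \<theta> A"
  obtains \<phi> where "\<phi> \<in> Linf_circle"
    "\<And>f g. f \<in> model_space \<theta> \<Longrightarrow> g \<in> model_space \<theta> \<Longrightarrow> L2_inner (A f) g = L2_inner (\<lambda>z. \<phi> z * f z) g"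
proof -
  obtain \<phi> where \<phi>: "\<phi> \<in> Linf_circle"
    and Aeq: "\<And>f. f \<in> model_space \<theta> \<Longrightarrow> L2_eq (A f) (model_proj \<theta> (\<lambda>z. \<phi> z * f z))"
    using A unfolding truncated_toeplitz_def by blast
  have "L2_inner (A f) g = L2_inner (\<lambda>z. \<phi> z * f z) g"
    if f: "f \<in> model_space \<theta>" and g: "g \<in> model_space \<theta>" for f g
  proof -
    let ?h = "\<lambda>z. \<phi> z * f z" and ?p = "model_proj \<theta> (\<lambda>z. \<phi> z * f z)"
    have h: "?h \<in> L2_circle"
      using \<phi> model_space_L2[OF f] by (auto simp: Linf_circle_def intro: L2_circle_mult_bounded)
    have p: "?p \<in> model_space \<theta>" "\<And>f. f \<in> model_space \<theta> \<Longrightarrow> L2_inner (\<lambda>z. ?h z - ?p z) f = 0"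
      using someI_ex[OF model_proj_exists[OF u h]] unfolding model_proj_def by auto
    have "L2_inner ?h g - L2_inner ?p g = 0"
      using p(2)[OF g] by (simp add: L2_inner_diff_left h model_space_L2 p(1) g)
    moreover have "L2_inner (A f) g = L2_inner ?p g"
      by (rule L2_inner_cong[OF Aeq[OF f] L2_eq_refl[OF model_space_L2[OF g]]])
    ultimately show ?thesis by simp
  qed
  then show ?thesis using \<phi> that by blast
qed

lemma op_matrix_change:
  fixes u v :: "'n::finite \<Rightarrow> complex \<Rightarrow> complex"
  assumes u: "C_real_basis \<theta> u" and U: "orthogonal_matrix (U :: real ^ 'n ^ 'n)"
    and v: "\<And>j. L2_eq (v j) (basis_map u (complex_matrix U *v axis j 1))"
    and A: "truncated_toeplitz \<theta> A"
  shows "op_matrix A v = matrix_inv (complex_matrix U) ** op_matrix A u ** complex_matrix U"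
proof -
  obtain \<phi> where \<phi>: "\<phi> \<in> Linf_circle"
    and inner: "\<And>f g. f \<in> model_space \<theta> \<Longrightarrow> g \<in> model_space \<theta> \<Longrightarrow>
      L2_inner (A f) g = L2_inner (\<lambda>z. \<phi> z * f z) g"
    using L2_inner_truncated_toeplitz[OF u A] by blast
  have mult_L2: "(\<lambda>z. \<phi> z * f z) \<in> L2_circle" if "f \<in> L2_circle" for f
    using \<phi> that by (auto simp: Linf_circle_def intro: L2_circle_mult_bounded)
  note uL2 = C_real_basisD(2)[OF u]
  note ums = C_real_basisD(1)[OF u]
  have vms: "v j \<in> model_space \<theta>" for j
    by (rule model_space_cong[OF _ v]) (intro model_space_basis_map ums)
  have "op_matrix A v $ i $ j
      = (\<Sum>k\<in>UNIV. \<Sum>l\<in>UNIV. complex_of_real (U $ l $ i) * op_matrix A u $ l $ k * of_real (U $ k $ j))" for i j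
  proof -
    let ?x = "complex_matrix U *v axis j 1" and ?y = "complex_matrix U *v axis i 1"
    have "L2_eq (\<lambda>z. \<phi> z * v j z) (\<lambda>z. \<phi> z * basis_map u ?x z)"
      using v[of j] by (auto simp: L2_eq_def mult_L2 elim: eventually_mono)
    then have "L2_inner (\<lambda>z. \<phi> z * v j z) (v i) = L2_inner (\<lambda>z. \<phi> z * basis_map u ?x z) (basis_map u ?y)"
      by (rule L2_inner_cong[OF _ v])
    also have "(\<lambda>z. \<phi> z * basis_map u ?x z) = basis_map (\<lambda>k z. \<phi> z * u k z) ?x"
      by (simp add: fun_eq_iff basis_map_def sum_distrib_left mult_ac)
    also have "L2_inner \<dots> (basis_map u ?y)
        = (\<Sum>k\<in>UNIV. ?x $ k * (\<Sum>l\<in>UNIV. cnj (?y $ l) * L2_inner (\<lambda>z. \<phi> z * u k z) (u l)))"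
      by (subst L2_inner_basis_map_left)
        (simp_all add: L2_inner_basis_map_right basis_map_L2_circle uL2 mult_L2)
    finally show ?thesis
      by (simp add: op_matrix_def inner vms ums complex_matrix_column sum_distrib_left mult_ac)
  qed
  then show ?thesis
    unfolding matrix_inv_complex_matrix[OF U]
    by (simp add: vec_eq_iff matrix_matrix_mult_def transpose_def sum_distrib_right)
qed

end

lemma finite_blaschke_imp_blaschke_product:
  assumes "finite_blaschke \<theta> n" "0 < n"
  shows "\<exists>c a. blaschke_product \<theta> n c a"
proof -
  obtain c a where "cmod c = 1" "\<forall>j<n. a j \<in> ball 0 1"
    "\<forall>z\<in>cball 0 1. \<theta> z = c * (\<Prod>j<n. (z - a j) / (1 - cnj (a j) * z))"
    using assms(1) unfolding finite_blaschke_def by blast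
  then have "blaschke_product \<theta> n c a"
    using assms(2) by unfold_locales auto
  then show ?thesis by blast
qed

theorem proposition4p1:
  fixes \<theta> :: "complex \<Rightarrow> complex"
  assumes "finite_blaschke \<theta> CARD('n::finite)"
  shows
    "(\<forall>(v :: 'n \<Rightarrow> complex \<Rightarrow> complex) (cb :: 'n \<Rightarrow> complex \<Rightarrow> complex).
        C_real_basis \<theta> v \<and> modified_clark_basis \<theta> cb \<longrightarrow>
        (\<exists>U :: real ^ 'n ^ 'n. orthogonal_matrix U \<and>
           (\<forall>i. L2_eq (v i) (basis_map cb (complex_matrix U *v axis i 1))))) \<and>
     (\<forall>(U :: real ^ 'n ^ 'n) (cb :: 'n \<Rightarrow> complex \<Rightarrow> complex).
        orthogonal_matrix U \<and> modified_clark_basis \<theta> cb \<longrightarrow>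
        C_real_basis \<theta> (\<lambda>i. basis_map cb (complex_matrix U *v axis i 1))) \<and>
     (\<forall>(U :: real ^ 'n ^ 'n) (cb :: 'n \<Rightarrow> complex \<Rightarrow> complex) (v :: 'n \<Rightarrow> complex \<Rightarrow> complex) A.
        orthogonal_matrix U \<and> modified_clark_basis \<theta> cb \<and>
        (\<forall>i. L2_eq (v i) (basis_map cb (complex_matrix U *v axis i 1))) \<and>
        truncated_toeplitz \<theta> A \<longrightarrow>
        op_matrix A v = matrix_inv (complex_matrix U) ** op_matrix A cb ** complex_matrix U)"
proof -
  obtain c a where "blaschke_product \<theta> CARD('n) c a"
    using finite_blaschke_imp_blaschke_product[OF assms] by auto
  then interpret blaschke_product \<theta> "CARD('n)" c a .
  show ?thesis
    using modified_clark_basis_is_C_real_basis[OF refl] C_real_basis_change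
      C_real_basis_orthogonal_image op_matrix_change by blast
qed

end
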